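(* Let $n>2$. (1) The orbit of any non-scalar matrix in $\mathrm{Sym}(n)$ intersects orthogonally the plane $\mathrm{Dg}$ of diagonal matrices. (2) The orbit of any matrix $A\in\mathrm{Sym}(n)$ lies in the affine hyperplane through $A$ orthogonal to the line $\mathrm{Scal}$ of scalar matrices. (3) The orbit of any matrix in $\mathcal{MH}$ is a smooth, compact, algebraic, connected surface of dimension $\dim\mathrm{SO}(n)-1=\frac{n(n-1)}{2}-1$.
   Context: $\mathrm{Sym}(n)$ is the space of real symmetric $n\times n$ matrices with inner product $\langle X,Y\rangle=\sum_{i,j}x_{i,j}y_{i,j}$, to which all orthogonality statements refer. The orbit of $A\in\mathrm{Sym}(n)$ is $\mathrm{Orbit}(A)=\{gAg^{*}\mid g\in\mathrm{SO}(n)\}$, $g^{*}$ being the transpose. $\mathrm{Scal}=\{cE\mid c\in\mathbb{R}\}$ with $E$ the identity matrix. $\mathcal{MH}$ is the set of matrices in $\mathrm{Sym}(n)$ having exactly $n-1$ different eigenvalues. An orbit intersects $\mathrm{Dg}$ orthogonally if at every point of intersection the tangent space of the orbit is orthogonal to $\mathrm{Dg}$. An algebraic surface is a common zero set in $\mathrm{Sym}(n)$ of finitely many real polynomials in the matrix entries; smooth means a smooth submanifold of $\mathrm{Sym}(n)$. *)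

theory Defs
  imports "HOL-Analysis.Analysis"
begin

section \<open>Symmetric matrices and orbits\<close>

text \<open>The inner product of \<^typ>\<open>real^'n^'n\<close> is the entrywise one, \<open>\<Sum>i j. X$i$j * Y$i$j\<close>.\<close>

definition Sym :: "(real^'n^'n) set" where
  "Sym = {A. transpose A = A}"

definition Dg :: "(real^'n^'n) set" where
  "Dg = {A. \<forall>i j. i \<noteq> j \<longrightarrow> A $ i $ j = 0}"

definition Scal :: "(real^'n^'n) set" where
  "Scal = {c *\<^sub>R mat 1 | c. True}"

definition SO :: "(real^'n^'n) set" where
  "SO = {g. rotation_matrix g}"

definition orbit :: "real^'n^'n \<Rightarrow> (real^'n^'n) set" where
  "orbit A = {g ** A ** transpose g | g. g \<in> SO}"

definition eigenvalues :: "real^'n^'n \<Rightarrow> real set" where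
  "eigenvalues A = {c. \<exists>v. v \<noteq> 0 \<and> A *v v = c *\<^sub>R v}"

definition MH :: "(real^'n^'n) set" where
  "MH = {A \<in> Sym. card (eigenvalues A) = CARD('n) - 1}"


section \<open>Smooth maps, submanifolds and tangent spaces\<close>

text \<open>\<open>Ck_on k f S\<close> is meant for open \<open>S\<close>. In finite dimension, quantifying over directions
  \<open>v\<close> is the same as differentiating the operator-valued derivative.\<close>

primrec Ck_on ::
  "nat \<Rightarrow> ('a::euclidean_space \<Rightarrow> 'b::real_normed_vector) \<Rightarrow> 'a set \<Rightarrow> bool" where
  "Ck_on 0 f S = continuous_on S f"
| "Ck_on (Suc k) f S =
     ((\<forall>x\<in>S. f differentiable (at x)) \<and>
      (\<forall>v. Ck_on k (\<lambda>x. frechet_derivative f (at x) v) S))"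

definition smooth_on :: "('a::euclidean_space \<Rightarrow> 'b::real_normed_vector) \<Rightarrow> 'a set \<Rightarrow> bool" where
  "smooth_on f S \<longleftrightarrow> (\<forall>k. Ck_on k f S)"

text \<open>\<open>M\<close> is an (embedded) smooth submanifold of dimension \<open>k\<close> of the linear space \<open>E\<close>: near each
  of its points it has a regular local parametrization, i.e. a smooth immersion of an open subset
  of a \<open>k\<close>-dimensional space that is a homeomorphism onto a neighbourhood of the point in \<open>M\<close>.
  Since \<open>k\<close> is not a type, a \<open>k\<close>-dimensional linear subspace \<open>W\<close> of the ambient type plays the
  role of \<open>\<real>\<^sup>k\<close>. The parameter domain is \<open>T \<inter> W\<close>; that the map is smooth on all of \<open>T\<close> is no
  restriction, because a smooth map on \<open>T \<inter> W\<close> extends by composition with the orthogonal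
  projection to \<open>W\<close>.\<close>

definition smooth_submanifold :: "'a::euclidean_space set \<Rightarrow> nat \<Rightarrow> 'a set \<Rightarrow> bool" where
  "smooth_submanifold E k M \<longleftrightarrow>
     M \<subseteq> E \<and>
     (\<forall>p\<in>M. \<exists>U (W :: 'a set) T \<phi> \<psi>.
        openin (top_of_set E) U \<and> p \<in> U \<and>
        subspace W \<and> dim W = k \<and> open T \<and>
        smooth_on \<phi> T \<and>
        (\<forall>x \<in> T \<inter> W. inj_on (frechet_derivative \<phi> (at x)) W) \<and>
        homeomorphism (T \<inter> W) (M \<inter> U) \<phi> \<psi>)"

definition tangent_space :: "'a::euclidean_space set \<Rightarrow> 'a \<Rightarrow> 'a set" where
  "tangent_space M p =
     {vector_derivative c (at 0) | c :: real \<Rightarrow> 'a.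
        \<exists>e>0. smooth_on c {-e<..<e} \<and> c ` {-e<..<e} \<subseteq> M \<and> c 0 = p}"

definition intersects_orthogonally :: "'a::euclidean_space set \<Rightarrow> 'a set \<Rightarrow> bool" where
  "intersects_orthogonally M L \<longleftrightarrow>
     M \<inter> L \<noteq> {} \<and>
     (\<forall>X \<in> M \<inter> L. \<forall>V \<in> tangent_space M X. \<forall>Y \<in> L. orthogonal V Y)"


section \<open>Algebraic surfaces\<close>

text \<open>\<^const>\<open>real_polynomial_function\<close> is generated from linear functionals and constants by sums
  and products; on \<^typ>\<open>real^'n^'n\<close> these are exactly the polynomials in the matrix entries.\<close>

definition algebraic_surface :: "(real^'n^'n) set \<Rightarrow> bool" where
  "algebraic_surface S \<longleftrightarrow>
     (\<exists>P. finite P \<and> (\<forall>f\<in>P. real_polynomial_function f) \<and>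
          S = {X \<in> Sym. \<forall>f\<in>P. f X = 0})"

end

theory Submission
  imports Defs "HOL-Combinatorics.Permutations"
begin

text \<open>Orbits are handled through the products \<open>m(X) = \<Prod>l. (X - l)\<close> over the distinct eigenvalues
  \<open>l\<close> of a diagonal representative.  The equation \<open>m(X) = 0\<close> and the traces of the partial products
  with one factor removed determine the spectrum with multiplicities, so they cut out the orbit.
  Along a curve \<open>c\<close> in the orbit through \<open>diagm a\<close>, removing the factor of the eigenvalue \<open>a i\<close> and
  differentiating \<open>m(c(t)) = 0\<close> gives that the \<open>i\<close>-th diagonal entry of the velocity vanishes.
  Near \<open>diagm a\<close> the orbit is already cut out of the symmetric matrices by the entries
  \<open>(i, j)\<close> of \<open>m(X)\<close> with \<open>a i = a j\<close>; together with the other entries of \<open>X\<close> as coordinates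
  they form a local diffeomorphism, and the inverse function theorem gives a chart.  Diagonalization
  and connectedness of the rotation group both follow by maximising a linear functional over a compact
  set and varying the maximiser by plane rotations.\<close>

section \<open>Calculus of \<^const>\<open>Ck_on\<close>\<close>

text \<open>A tangent vector comes from an arbitrary smooth curve in the orbit, which is not given
  as conjugation by a smooth curve in \<open>SO\<close>; equations valid on the whole orbit avoid
  lifting it. The full equation \<open>m(X) = 0\<close> is no chart: at \<open>diagm a\<close> the
  derivative of \<open>m\<close> multiplies the entry (i, j) by the divided difference of the scalar
  polynomial at \<open>a i\<close> and \<open>a j\<close>, which is 0 for distinct roots and nonzero
  for equal ones, the roots being simple. So only entries in the blocks \<open>a i = a j\<close>
  give differentials independent up to symmetry. Near \<open>diagm a\<close> the other entries of
  \<open>m(X)\<close> then vanish by themselves, because \<open>m(X)\<close> commutes with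
  \<open>X\<close>, and the traces cannot jump, being discrete on the zeros of \<open>m\<close>.
  Charts are parametrized by subspaces of the matrix type, so each is the inverse of a local
  diffeomorphism of all matrices. The inverse function theorem enters in its C^1 form; iterating the
  formula for the derivative of the inverse gives smoothness.\<close>

lemma Ck_on_cong:
  fixes f g :: "'a::euclidean_space \<Rightarrow> 'b::real_normed_vector"
  assumes "open S" "Ck_on k f S" "\<And>x. x \<in> S \<Longrightarrow> f x = g x"
  shows "Ck_on k g S"
  using assms(2,3)
proof (induction k arbitrary: f g)
  case 0
  then show ?case by (metis Ck_on.simps(1) continuous_on_cong)
next
  case (Suc k)
  have der: "(g has_derivative frechet_derivative f (at x)) (at x)" if x: "x \<in> S" for x
  proof -
    have "(f has_derivative frechet_derivative f (at x)) (at x)"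
      using Suc.prems(1) x frechet_derivative_works by auto
    then show ?thesis
      by (rule has_derivative_transform_within_open[OF _ assms(1) x Suc.prems(2)])
  qed
  have "Ck_on k (\<lambda>x. frechet_derivative g (at x) v) S" for v
  proof (rule Suc.IH)
    show "Ck_on k (\<lambda>x. frechet_derivative f (at x) v) S" using Suc.prems(1) by simp
  qed (metis der frechet_derivative_at)
  then show ?case using der by (auto intro: differentiableI)
qed

text \<open>\<open>frechet_derivative\<close> is a choice operator; by uniqueness of derivatives an
  explicit formula \<open>f'\<close> may stand in for it. The later smoothness inductions enter
  through this rule.\<close>

lemma Ck_on_SucI:
  assumes "open S" "\<And>x. x \<in> S \<Longrightarrow> (f has_derivative f' x) (at x)"
    and "\<And>v. Ck_on k (\<lambda>x. f' x v) S"
  shows "Ck_on (Suc k) f S"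
  unfolding Ck_on.simps
proof (intro conjI ballI allI)
  fix x assume "x \<in> S" then show "f differentiable at x" using assms(2) differentiable_def by blast
next
  fix v show "Ck_on k (\<lambda>x. frechet_derivative f (at x) v) S"
    by (rule Ck_on_cong[OF assms(1) assms(3)[of v]]) (metis assms(2) frechet_derivative_at)
qed

lemma Ck_on_has_derivative:
  assumes "Ck_on (Suc k) f S" "x \<in> S"
  shows "(f has_derivative frechet_derivative f (at x)) (at x)"
  using assms frechet_derivative_works by auto

lemma Ck_on_SucD: "Ck_on (Suc k) f S \<Longrightarrow> Ck_on k f S"
proof (induction k arbitrary: f)
  case 0
  then show ?case
    by (auto intro!: continuous_at_imp_continuous_on differentiable_imp_continuous_within)
next
  case (Suc k)
  from Suc.prems have 1: "\<forall>x\<in>S. f differentiable (at x)"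
    "\<And>v. Ck_on (Suc k) (\<lambda>x. frechet_derivative f (at x) v) S"
    unfolding Ck_on.simps(2)[of "Suc k"] by auto
  show ?case unfolding Ck_on.simps(2)[of k] using 1(1) Suc.IH[OF 1(2)] by auto
qed

lemma Ck_on_imp_continuous_on: "Ck_on k f S \<Longrightarrow> continuous_on S f"
proof (induction k)
  case (Suc k) then show ?case using Ck_on_SucD by blast
qed simp

lemma Ck_on_subset:
  "Ck_on k f S \<Longrightarrow> T \<subseteq> S \<Longrightarrow> Ck_on k f T"
  by (induction k arbitrary: f) (auto intro: continuous_on_subset)

lemma Ck_on_const: "open S \<Longrightarrow> Ck_on k (\<lambda>x. c) S"
proof (induction k arbitrary: c)
  case (Suc k)
  show ?case by (rule Ck_on_SucI[where f'="\<lambda>x v. 0"]) (use Suc in auto)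
qed simp

lemma Ck_on_bounded_linear:
  assumes "bounded_linear L" "open S" "Ck_on k f S"
  shows "Ck_on k (\<lambda>x. L (f x)) S"
  using assms(3)
proof (induction k arbitrary: f)
  case 0
  then show ?case using assms(1) by (simp add: bounded_linear.continuous_on)
next
  case (Suc k)
  show ?case
    by (rule Ck_on_SucI[OF assms(2), where f'="\<lambda>x v. L (frechet_derivative f (at x) v)"])
      (use Suc in \<open>auto intro: bounded_linear.has_derivative[OF assms(1)] simp: frechet_derivative_works\<close>)
qed

lemma Ck_on_ident: "open S \<Longrightarrow> Ck_on k (\<lambda>x. x) S"
proof (cases k)
  case (Suc m)
  assume "open S"
  then show ?thesis unfolding Suc
    by (intro Ck_on_SucI[where f'="\<lambda>x v. v"]) (auto intro: Ck_on_const)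
qed simp

lemma Ck_on_add:
  assumes "open S" "Ck_on k f S" "Ck_on k g S"
  shows "Ck_on k (\<lambda>x. f x + g x) S"
  using assms(2,3)
proof (induction k arbitrary: f g)
  case 0
  then show ?case by (simp add: continuous_on_add)
next
  case (Suc k)
  show ?case
    by (rule Ck_on_SucI[OF assms(1), where
          f'="\<lambda>x v. frechet_derivative f (at x) v + frechet_derivative g (at x) v"])
      (use Suc in \<open>auto intro!: has_derivative_add simp: frechet_derivative_works\<close>)
qed

lemma Ck_on_sum:
  assumes "open S" "\<And>i. i \<in> I \<Longrightarrow> Ck_on k (f i) S"
  shows "Ck_on k (\<lambda>x. \<Sum>i\<in>I. f i x) S"
  using assms(2)
  by (induction I rule: infinite_finite_induct) (auto intro!: Ck_on_add Ck_on_const assms(1))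

text \<open>Both terms of the product rule are again products, whose undifferentiated factor has an
  order of smoothness to spare; hence the induction runs over all pairs of factors.\<close>

lemma (in bounded_bilinear) Ck_on:
  fixes f :: "'d::euclidean_space \<Rightarrow> 'a"
  assumes "open S" "Ck_on k f S" "Ck_on k g S"
  shows "Ck_on k (\<lambda>x. prod (f x) (g x)) S"
  using assms(2,3)
proof (induction k arbitrary: f g)
  case 0
  then show ?case by (simp add: continuous_on)
next
  case (Suc k)
  show ?case
  proof (rule Ck_on_SucI[OF assms(1), where f'="\<lambda>x v.
        prod (f x) (frechet_derivative g (at x) v) + prod (frechet_derivative f (at x) v) (g x)"])
    fix v
    show "Ck_on k (\<lambda>x. prod (f x) (frechet_derivative g (at x) v) + prod (frechet_derivative f (at x) v) (g x)) S"
      using Suc.prems by (intro Ck_on_add assms(1) Suc.IH) (auto dest: Ck_on_SucD simp del: Ck_on.simps, auto)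
  qed (use Suc.prems in \<open>auto intro!: FDERIV simp: frechet_derivative_works\<close>)
qed

lemma Ck_on_compose:
  fixes f :: "'a::euclidean_space \<Rightarrow> 'b::euclidean_space" and g :: "'b \<Rightarrow> 'c::real_normed_vector"
  assumes "open S" "open T" "f ` S \<subseteq> T" "Ck_on k f S" "Ck_on k g T"
  shows "Ck_on k (\<lambda>x. g (f x)) S"
  using assms(4,5)
proof (induction k arbitrary: g)
  case 0
  then show ?case using assms(3) by (auto intro: continuous_on_compose2)
next
  case (Suc k)
  let ?f' = "\<lambda>x. frechet_derivative f (at x)" and ?g' = "\<lambda>y. frechet_derivative g (at y)"
  have df: "(f has_derivative ?f' x) (at x)" if "x \<in> S" for x
    using Ck_on_has_derivative[OF Suc.prems(1) that] .
  have dg: "(g has_derivative ?g' (f x)) (at (f x))" if "x \<in> S" for x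
    using Ck_on_has_derivative[OF Suc.prems(2)] that assms(3) by blast
  show ?case
  proof (rule Ck_on_SucI[OF assms(1), where f'="\<lambda>x v. ?g' (f x) (?f' x v)"])
    fix x assume "x \<in> S"
    from diff_chain_at[OF df[OF this] dg[OF this]]
    show "((\<lambda>x. g (f x)) has_derivative (\<lambda>v. ?g' (f x) (?f' x v))) (at x)"
      by (simp add: o_def)
  next
    fix v
    \<comment> \<open>\<open>Ck_on\<close> controls \<open>?g'\<close> in fixed directions only,
      while the direction \<open>?f' x v\<close> moves with \<open>x\<close>; the basis expansion
      separates the two dependences.\<close>
    have "Ck_on k (\<lambda>x. \<Sum>b\<in>Basis. (?f' x v \<bullet> b) *\<^sub>R ?g' (f x) b) S"
    proof (intro Ck_on_sum assms(1) bounded_bilinear.Ck_on[OF bounded_bilinear_scaleR])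
      fix b :: 'b
      show "Ck_on k (\<lambda>x. ?f' x v \<bullet> b) S"
        using Suc.prems(1) by (intro Ck_on_bounded_linear[OF bounded_linear_inner_left] assms(1)) auto
      show "Ck_on k (\<lambda>x. ?g' (f x) b) S"
        by (rule Suc.IH[OF Ck_on_SucD[OF Suc.prems(1)]]) (use Suc.prems(2) in auto)
    qed
    then show "Ck_on k (\<lambda>x. ?g' (f x) (?f' x v)) S"
    proof (rule Ck_on_cong[OF assms(1)])
      fix x assume "x \<in> S"
      then have lin: "linear (?g' (f x))"
        using dg has_derivative_linear by blast
      have "?g' (f x) (?f' x v) = ?g' (f x) (\<Sum>b\<in>Basis. (?f' x v \<bullet> b) *\<^sub>R b)"
        by (simp add: euclidean_representation)
      also have "\<dots> = (\<Sum>b\<in>Basis. (?f' x v \<bullet> b) *\<^sub>R ?g' (f x) b)"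
        by (simp add: linear_sum[OF lin] linear_cmul[OF lin])
      finally show "(\<Sum>b\<in>Basis. (?f' x v \<bullet> b) *\<^sub>R ?g' (f x) b) = ?g' (f x) (?f' x v)" by simp
    qed
  qed
qed

text \<open>The increment of \<open>h\<close> meets \<open>f' (y - x)\<close>, which is already of
  first order, so continuity of \<open>h\<close> makes that term negligible. This serves factors
  \<open>h\<close> whose differentiability is unknown, such as an inverse still to be
  differentiated.\<close>

lemma has_derivative_scaleR_at_zero:
  fixes f :: "'a::euclidean_space \<Rightarrow> 'b::real_normed_vector"
  assumes f: "(f has_derivative f') (at x)" and "f x = 0" and h: "isCont h x"
  shows "((\<lambda>y. h y *\<^sub>R f y) has_derivative (\<lambda>u. h x *\<^sub>R f' u)) (at x)"
proof -
  have bl: "bounded_linear f'" using f has_derivative_bounded_linear by blast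
  obtain K where K: "\<And>u. norm (f' u) \<le> norm u * K" using bounded_linear.bounded[OF bl] by blast
  have lim: "((\<lambda>y. (1 / norm (y - x)) *\<^sub>R (f y - f' (y - x))) \<longlongrightarrow> 0) (at x)"
    using f \<open>f x = 0\<close> unfolding has_derivative_at2 by simp
  have hlim: "(h \<longlongrightarrow> h x) (at x)" using h by (simp add: isCont_def)
  have 1: "((\<lambda>y. h y *\<^sub>R ((1 / norm (y - x)) *\<^sub>R (f y - f' (y - x)))) \<longlongrightarrow> 0) (at x)"
    using tendsto_scaleR[OF hlim lim] by simp
  have 2: "((\<lambda>y. (h y - h x) *\<^sub>R ((1 / norm (y - x)) *\<^sub>R f' (y - x))) \<longlongrightarrow> 0) (at x)"
  proof (rule Lim_null_comparison)
    show "((\<lambda>y. \<bar>h y - h x\<bar> * \<bar>K\<bar>) \<longlongrightarrow> 0) (at x)"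
      using hlim by (auto intro!: tendsto_eq_intros)
    have "norm ((h y - h x) *\<^sub>R ((1 / norm (y - x)) *\<^sub>R f' (y - x))) \<le> \<bar>h y - h x\<bar> * \<bar>K\<bar>" if "y \<noteq> x" for y
    proof -
      have "norm (f' (y - x)) \<le> norm (y - x) * \<bar>K\<bar>"
        using K[of "y - x"] by (meson abs_ge_self mult_left_mono norm_ge_zero order_trans)
      then have "norm (f' (y - x)) / norm (y - x) \<le> \<bar>K\<bar>"
        using that by (simp add: divide_simps mult.commute)
      then have "\<bar>h y - h x\<bar> * (norm (f' (y - x)) / norm (y - x)) \<le> \<bar>h y - h x\<bar> * \<bar>K\<bar>"
        by (intro mult_left_mono) auto
      then show ?thesis by simp
    qed
    then show "\<forall>\<^sub>F y in at x. norm ((h y - h x) *\<^sub>R ((1 / norm (y - x)) *\<^sub>R f' (y - x))) \<le> \<bar>h y - h x\<bar> * \<bar>K\<bar>"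
      by (auto simp: eventually_at_filter)
  qed
  have "((\<lambda>y. (1 / norm (y - x)) *\<^sub>R (h y *\<^sub>R f y - h x *\<^sub>R f' (y - x))) \<longlongrightarrow> 0) (at x)"
    using tendsto_add[OF 1 2] by (simp add: scaleR_diff_right scaleR_diff_left diff_divide_distrib)
  moreover have "bounded_linear (\<lambda>u. h x *\<^sub>R f' u)"
    using bl by (rule bounded_linear_const_scaleR)
  ultimately show ?thesis
    unfolding has_derivative_at2 using \<open>f x = 0\<close> by (simp add: algebra_simps)
qed

section \<open>Inverses of linear maps depending on a parameter\<close>

lemma linear_inv_self:
  fixes f :: "'a::euclidean_space \<Rightarrow> 'a"
  assumes "linear f" "inj f"
  shows "linear (inv f)" "f (inv f v) = v" "inv f (f v) = v"
proof -
  have s: "surj f" using linear_injective_imp_surjective[OF assms] by simp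
  then show "f (inv f v) = v" by (simp add: surj_f_inv_f)
  show "inv f (f v) = v" using assms(2) by simp
  obtain g where "linear g" "f \<circ> g = id" using linear_surjective_right_inverse[OF assms(1) s] by blast
  moreover have "inv f = g" using calculation s assms(2)
    by (metis inv_unique_comp bij_def inv_o_cancel o_assoc id_o o_id comp_assoc)
  ultimately show "linear (inv f)" by simp
qed

lemma linear_componentwise_sum:
  assumes "linear (f :: 'a::euclidean_space \<Rightarrow> 'b::real_vector)"
  shows "f v = (\<Sum>b\<in>Basis. (v \<bullet> b) *\<^sub>R f b)"
proof -
  have "f v = f (\<Sum>b\<in>Basis. (v \<bullet> b) *\<^sub>R b)" by (simp add: euclidean_representation)
  then show ?thesis by (simp add: linear_sum[OF assms] linear_cmul[OF assms])
qed

text \<open>This is the rule d(A^-1) v = - A^-1 (dA) A^-1 v, expanded in the basis because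
  \<open>A\<close> is differentiated only through its values \<open>A y b\<close>.\<close>

lemma has_derivative_inv_linear:
  fixes A :: "'a::euclidean_space \<Rightarrow> 'b::euclidean_space \<Rightarrow> 'b"
  assumes S: "open S" "x \<in> S"
    and lin: "\<And>y. y \<in> S \<Longrightarrow> linear (A y)" and inj: "\<And>y. y \<in> S \<Longrightarrow> inj (A y)"
    and dA: "\<And>b. ((\<lambda>y. A y b) has_derivative A' b) (at x)"
  shows "((\<lambda>y. inv (A y) v) has_derivative
    (\<lambda>u. - inv (A x) (\<Sum>c\<in>Basis. (inv (A x) v \<bullet> c) *\<^sub>R A' c u))) (at x)"
proof -
  define B where "B = inv (A x)"
  define N where "N = (\<lambda>y. inv (A y) v)"
  have linB: "linear B" unfolding B_def using linear_inv_self lin inj S by blast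
  then have blB: "bounded_linear B" by (simp add: linear_linear)
  obtain K where K: "K > 0" "\<And>u. norm (B u) \<le> K * norm u"
    using linear_bounded_pos[OF linB] by blast
  \<comment> \<open>The unknown \<open>N\<close> occurs on the right only as a factor of differences
    vanishing at \<open>x\<close>, so its continuity at \<open>x\<close> will suffice to
    differentiate this identity.\<close>
  have eq: "N y = B v - B (\<Sum>c\<in>Basis. (N y \<bullet> c) *\<^sub>R (A y c - A x c))" if "y \<in> S" for y
  proof -
    have "(\<Sum>c\<in>Basis. (N y \<bullet> c) *\<^sub>R (A y c - A x c)) = A y (N y) - A x (N y)"
      by (simp add: scaleR_diff_right sum_subtractf linear_componentwise_sum[OF lin[OF that], of "N y"]
          linear_componentwise_sum[OF lin[OF S(2)], of "N y"])
    also have "\<dots> = v - A x (N y)"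
      unfolding N_def using linear_inv_self(2) lin inj that by metis
    finally show ?thesis
      using linear_inv_self(3)[OF lin inj, of x "N y"] S(2) linear_diff[OF linB] by (simp add: B_def)
  qed
  define e where "e = (\<lambda>y. \<Sum>c\<in>Basis. norm (A y c - A x c))"
  have contA: "isCont (\<lambda>y. A y c) x" for c
    using has_derivative_continuous[OF dA] .
  have elim: "(e \<longlongrightarrow> 0) (at x)"
  proof -
    have "(e \<longlongrightarrow> (\<Sum>c\<in>Basis. norm (A x c - A x c))) (at x)"
      unfolding e_def using contA by (intro tendsto_intros) (auto simp: isCont_def)
    then show ?thesis by simp
  qed
  have Bbd: "norm (B (\<Sum>c\<in>Basis. (N y \<bullet> c) *\<^sub>R (A y c - A x c))) \<le> K * (norm (N y) * e y)" for y
  proof -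
    have "norm (\<Sum>c\<in>Basis. (N y \<bullet> c) *\<^sub>R (A y c - A x c)) \<le> (\<Sum>c\<in>Basis. norm (N y) * norm (A y c - A x c))"
      by (rule order_trans[OF norm_sum sum_mono]) (auto intro!: mult_right_mono Basis_le_norm)
    also have "\<dots> = norm (N y) * e y" by (simp add: e_def sum_distrib_left)
    finally have "K * norm (\<Sum>c\<in>Basis. (N y \<bullet> c) *\<^sub>R (A y c - A x c)) \<le> K * (norm (N y) * e y)"
      using K(1) by simp
    then show ?thesis using K(2) order_trans by blast
  qed
  have evS: "\<forall>\<^sub>F y in at x. y \<in> S" using S by (simp add: eventually_at_in_open')
  \<comment> \<open>Below \<open>1 / (2 * K)\<close> the implicit term is at most half of
    \<open>norm (N y)\<close> and is absorbed; this bounds \<open>N\<close> near \<open>x\<close>,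
    and the bound yields continuity.\<close>
  have eve: "\<forall>\<^sub>F y in at x. e y < 1 / (2 * K)"
    using order_tendstoD(2)[OF elim, of "1 / (2 * K)"] K(1) by simp
  have epos: "e y \<ge> 0" for y unfolding e_def by (simp add: sum_nonneg)
  have Nx: "N x = B v" by (simp add: N_def B_def)
  have close: "\<forall>\<^sub>F y in at x. norm (N y - N x) \<le> K * (2 * K * norm v) * e y"
    using evS eve
  proof eventually_elim
    case (elim y)
    define r where "r = B (\<Sum>c\<in>Basis. (N y \<bullet> c) *\<^sub>R (A y c - A x c))"
    have r: "N y = B v - r" "norm r \<le> K * (norm (N y) * e y)"
      using eq[OF elim(1)] Bbd[of y] by (simp_all only: r_def)
    have "norm (N y) \<le> norm (B v) + norm r"
      unfolding r(1) by (rule norm_triangle_ineq4)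
    with r(2) have "norm (N y) \<le> norm (B v) + K * (norm (N y) * e y)" by linarith
    moreover have "K * (norm (N y) * e y) \<le> norm (N y) / 2"
    proof -
      have "K * e y \<le> 1 / 2" using elim(2) K(1) by (simp add: field_simps)
      then have "norm (N y) * (K * e y) \<le> norm (N y) * (1 / 2)" by (intro mult_left_mono) auto
      then show ?thesis by (simp add: mult_ac)
    qed
    ultimately have "norm (N y) \<le> 2 * K * norm v" using K(2)[of v] by simp
    then have "K * (norm (N y) * e y) \<le> K * (2 * K * norm v * e y)"
      using K(1) epos by (intro mult_left_mono mult_right_mono) auto
    moreover have "norm (N y - N x) \<le> K * (norm (N y) * e y)"
    proof -
      have "N y - N x = - r" using r(1) Nx by simp
      then show ?thesis using r(2) by (metis norm_minus_cancel)
    qed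
    ultimately show ?case by (simp add: mult_ac)
  qed
  have contN: "isCont N x"
  proof -
    have "((\<lambda>y. K * (2 * K * norm v) * e y) \<longlongrightarrow> 0) (at x)"
      using tendsto_mult_left[OF elim, of "K * (2 * K * norm v)"] by simp
    from Lim_null_comparison[OF close this] show ?thesis
      by (simp add: isCont_def LIM_zero_iff)
  qed
  have "((\<lambda>y. B v - B (\<Sum>c\<in>Basis. (N y \<bullet> c) *\<^sub>R (A y c - A x c))) has_derivative
      (\<lambda>u. 0 - B (\<Sum>c\<in>Basis. (N x \<bullet> c) *\<^sub>R A' c u))) (at x)"
    by (intro has_derivative_diff has_derivative_const bounded_linear.has_derivative[OF blB]
        has_derivative_sum has_derivative_scaleR_at_zero)
      (use dA contN in \<open>auto intro!: derivative_eq_intros\<close>)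
  then have "(N has_derivative (\<lambda>u. 0 - B (\<Sum>c\<in>Basis. (N x \<bullet> c) *\<^sub>R A' c u))) (at x)"
    by (rule has_derivative_transform_within_open[OF _ S]) (rule eq[symmetric])
  then show ?thesis by (simp add: N_def B_def)
qed

text \<open>The derivative of the inverse is built from the inverse itself and derivatives of
  \<open>A\<close>, so each order of smoothness follows from the preceding one.\<close>

lemma Ck_on_inv_linear:
  fixes A :: "'a::euclidean_space \<Rightarrow> 'b::euclidean_space \<Rightarrow> 'b"
  assumes S: "open S"
    and lin: "\<And>y. y \<in> S \<Longrightarrow> linear (A y)" and inj: "\<And>y. y \<in> S \<Longrightarrow> inj (A y)"
    and A: "\<And>b k. Ck_on k (\<lambda>y. A y b) S"
  shows "Ck_on k (\<lambda>x. inv (A x) v) S"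
proof (induction k arbitrary: v)
  let ?A' = "\<lambda>x c. frechet_derivative (\<lambda>y. A y c) (at x)"
  have der: "((\<lambda>y. inv (A y) v) has_derivative
    (\<lambda>u. - inv (A x) (\<Sum>c\<in>Basis. (inv (A x) v \<bullet> c) *\<^sub>R ?A' x c u))) (at x)" if "x \<in> S" for x v
    by (rule has_derivative_inv_linear[OF S that lin inj Ck_on_has_derivative[OF A that]])
  {
    case 0
    have "continuous_on S (\<lambda>x. inv (A x) v)"
      using der has_derivative_continuous by (blast intro: continuous_at_imp_continuous_on)
    then show ?case by simp
  next
    case (Suc k)
    show ?case
    proof (rule Ck_on_SucI[OF S der])
      fix u
      \<comment> \<open>The outer inverse acts on a vector moving with \<open>x\<close>, whereas the
        induction hypothesis has a fixed one; the basis expansion bridges this, and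
        \<open>- e\<close> carries the sign.\<close>
      have "Ck_on k (\<lambda>x. \<Sum>e\<in>Basis. ((\<Sum>c\<in>Basis. (inv (A x) v \<bullet> c) *\<^sub>R ?A' x c u) \<bullet> (- e)) *\<^sub>R inv (A x) e) S"
      proof (intro Ck_on_sum S bounded_bilinear.Ck_on[OF bounded_bilinear_scaleR] Suc.IH
          Ck_on_bounded_linear[OF bounded_linear_inner_left])
        fix c show "Ck_on k (\<lambda>x. ?A' x c u) S" using A[of "Suc k" c] by simp
      qed
      then show "Ck_on k (\<lambda>x. - inv (A x) (\<Sum>c\<in>Basis. (inv (A x) v \<bullet> c) *\<^sub>R ?A' x c u)) S"
      proof (rule Ck_on_cong[OF S])
        fix x assume "x \<in> S"
        then have "linear (inv (A x))" using linear_inv_self lin inj by blast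
        from linear_componentwise_sum[OF this, of "\<Sum>c\<in>Basis. (inv (A x) v \<bullet> c) *\<^sub>R ?A' x c u"]
        show "(\<Sum>e\<in>Basis. ((\<Sum>c\<in>Basis. (inv (A x) v \<bullet> c) *\<^sub>R ?A' x c u) \<bullet> (- e)) *\<^sub>R inv (A x) e) =
          - inv (A x) (\<Sum>c\<in>Basis. (inv (A x) v \<bullet> c) *\<^sub>R ?A' x c u)"
          by (simp add: sum_negf)
      qed
    qed
  }
qed

section \<open>Smooth local inverses and charts\<close>

text \<open>Bootstrapping: the derivative of \<open>\<phi>\<close> at \<open>y\<close> is the
  inverse of the derivative of \<open>F\<close> at \<open>\<phi> y\<close>. If \<open>\<phi>\<close>
  is C^k, this composite is C^k, hence \<open>\<phi>\<close> is C^(k+1).\<close>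

lemma smooth_local_inverse:
  fixes F :: "'a::euclidean_space \<Rightarrow> 'a"
  assumes F: "smooth_on F UNIV" and inj: "inj (frechet_derivative F (at p))"
  obtains V T \<phi> where "open V" "p \<in> V" "open T" "homeomorphism V T F \<phi>" "smooth_on \<phi> T"
    "\<And>y. y \<in> T \<Longrightarrow> inj (frechet_derivative \<phi> (at y))"
proof -
  let ?D = "\<lambda>x. frechet_derivative F (at x)"
  have CkF: "Ck_on k F UNIV" for k using F by (simp add: smooth_on_def)
  have der: "(F has_derivative ?D x) (at x)" for x using Ck_on_has_derivative[OF CkF] by simp
  have bl: "bounded_linear (?D x)" for x using der has_derivative_bounded_linear by blast
  have linD: "linear (?D x)" for x using bl by (simp add: linear_linear)
  define F' where "F' = (\<lambda>x. Blinfun (?D x))"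
  have F'[simp]: "blinfun_apply (F' x) = ?D x" for x
    unfolding F'_def using bl by (simp add: bounded_linear_Blinfun_apply)
  have CkD: "Ck_on k (\<lambda>x. ?D x v) UNIV" for k v using CkF[of "Suc k"] by simp
  \<comment> \<open>Continuity in operator norm follows from continuity in each direction, the
    dimension being finite.\<close>
  have contF': "continuous_on UNIV F'"
    by (rule continuous_on_blinfun_componentwise) (use CkD[of 0] in simp)
  have "linear (inv (?D p))" using linear_inv_self[OF linD inj] by blast
  then have "bounded_linear (inv (?D p))" by (simp add: linear_linear)
  then have inv: "Blinfun (inv (?D p)) o\<^sub>L F' p = id_blinfun"
    by (intro blinfun_eqI) (simp add: bounded_linear_Blinfun_apply linear_inv_self(3)[OF linD inj])
  obtain V T \<phi> \<phi>' where V: "open V" "p \<in> V" "open T" "homeomorphism V T F \<phi>"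
    and d\<phi>: "\<And>y. y \<in> T \<Longrightarrow> (\<phi> has_derivative (\<phi>' y)) (at y)"
    and \<phi>': "\<And>y. y \<in> T \<Longrightarrow> \<phi>' y = inv (blinfun_apply (F' (\<phi> y)))"
    and bij: "\<And>y. y \<in> T \<Longrightarrow> bij (blinfun_apply (F' (\<phi> y)))"
    by (rule inverse_function_theorem[of UNIV F F' p "Blinfun (inv (?D p))"])
      (use der contF' inv in auto)
  have V2: "inj (?D x)" if "x \<in> V" for x
  proof -
    have "F x \<in> T" "\<phi> (F x) = x" using V(4) that by (auto simp: homeomorphism_def)
    then show ?thesis using bij[of "F x"] by (auto simp: bij_def)
  qed
  have \<phi>V: "\<phi> ` T \<subseteq> V" using V(4) by (simp add: homeomorphism_def)
  have Ck\<phi>: "Ck_on k \<phi> T" for k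
  proof (induction k)
    case 0
    then show ?case using V(4) by (simp add: homeomorphism_def)
  next
    case (Suc k)
    show ?case
    proof (rule Ck_on_SucI[OF V(3) d\<phi>])
      fix v
      have "Ck_on k (\<lambda>x. inv (?D x) v) V"
        by (rule Ck_on_inv_linear[OF V(1) linD V2]) (use CkD Ck_on_subset in blast)+
      from Ck_on_compose[OF V(3,1) \<phi>V Suc.IH this]
      show "Ck_on k (\<lambda>y. \<phi>' y v) T"
        by (rule Ck_on_cong[OF V(3)]) (simp add: \<phi>')
    qed
  qed
  show thesis
  proof (rule that[OF V])
    show "smooth_on \<phi> T" using Ck\<phi> by (simp add: smooth_on_def)
    fix y assume y: "y \<in> T"
    then have "frechet_derivative \<phi> (at y) = inv (blinfun_apply (F' (\<phi> y)))"
      using d\<phi> \<phi>' frechet_derivative_at by metis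
    then show "inj (frechet_derivative \<phi> (at y))"
      using bij[OF y] by (metis bij_def bij_imp_bij_inv)
  qed
qed

text \<open>\<open>F\<close> straightens \<open>M\<close> near \<open>p\<close> to the subspace
  \<open>W\<close>; its local inverse, restricted to \<open>W\<close>, is the required
  parametrization.\<close>

lemma smooth_submanifoldI_local_diffeo:
  fixes M :: "'a::euclidean_space set"
  assumes "M \<subseteq> E"
    and loc: "\<And>p. p \<in> M \<Longrightarrow> \<exists>(F :: 'a \<Rightarrow> 'a) W N. smooth_on F UNIV \<and> inj (frechet_derivative F (at p)) \<and>
      subspace W \<and> dim W = k \<and> open N \<and> p \<in> N \<and> (\<forall>X\<in>N. X \<in> M \<longleftrightarrow> F X \<in> W)"
  shows "smooth_submanifold E k M"
  unfolding smooth_submanifold_def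
proof (intro conjI ballI)
  show "M \<subseteq> E" by fact
  fix p assume p: "p \<in> M"
  obtain F :: "'a \<Rightarrow> 'a" and W N where F: "smooth_on F UNIV" "inj (frechet_derivative F (at p))"
    and W: "subspace W" "dim W = k" and N: "open N" "p \<in> N" "\<forall>X\<in>N. X \<in> M \<longleftrightarrow> F X \<in> W"
    using loc[OF p] by blast
  obtain V T \<phi> where V: "open V" "p \<in> V" "open T" "homeomorphism V T F \<phi>" "smooth_on \<phi> T"
    and inj: "\<And>y. y \<in> T \<Longrightarrow> inj (frechet_derivative \<phi> (at y))"
    using smooth_local_inverse[OF F] by blast
  \<comment> \<open>Shrinks the parameter domain so that the chart stays in \<open>N\<close>, where
    \<open>M\<close> is the preimage of \<open>W\<close>.\<close>
  define T' where "T' = T \<inter> \<phi> -` N"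
  have "continuous_on T \<phi>" using V(4) by (simp add: homeomorphism_def)
  then have T': "open T'" unfolding T'_def
    using V(3) N(1) by (metis Int_commute continuous_on_open_vimage)
  have Veq: "homeomorphism (V \<inter> N) T' F \<phi>"
  proof (rule homeomorphism_of_subsets[OF V(4) _ order_refl])
    show "F ` (V \<inter> N) = T'"
    proof (intro equalityI subsetI)
      fix y assume "y \<in> T'"
      then have "\<phi> y \<in> V \<inter> N" "F (\<phi> y) = y" using V(4) by (auto simp: homeomorphism_def T'_def)
      then show "y \<in> F ` (V \<inter> N)" by (metis image_eqI)
    qed (use V(4) in \<open>auto simp: homeomorphism_def T'_def\<close>)
  qed (auto simp: T'_def)
  have "homeomorphism (T' \<inter> W) (M \<inter> (V \<inter> N \<inter> E)) \<phi> F"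
  proof (rule homeomorphism_of_subsets[OF homeomorphism_symD[OF Veq] _ order_refl])
    show "\<phi> ` (T' \<inter> W) = M \<inter> (V \<inter> N \<inter> E)"
    proof (intro equalityI subsetI)
      fix X assume "X \<in> \<phi> ` (T' \<inter> W)"
      then obtain y where y: "y \<in> T'" "y \<in> W" "X = \<phi> y" by blast
      then have "X \<in> V \<inter> N" "F X = y" using Veq by (auto simp: homeomorphism_def)
      then show "X \<in> M \<inter> (V \<inter> N \<inter> E)" using N(3) y assms(1) by auto
    next
      fix X assume X: "X \<in> M \<inter> (V \<inter> N \<inter> E)"
      then have "F X \<in> T'" "\<phi> (F X) = X" using Veq by (auto simp: homeomorphism_def)
      then show "X \<in> \<phi> ` (T' \<inter> W)" using X N(3) by (metis IntD1 IntD2 IntI image_eqI)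
    qed
  qed auto
  moreover have "openin (top_of_set E) (V \<inter> N \<inter> E)"
    using V(1) N(1) by (metis Int_commute open_Int openin_open_Int)
  moreover have "smooth_on \<phi> T'"
    using V(5) Ck_on_subset unfolding smooth_on_def T'_def by blast
  moreover have "\<forall>x \<in> T' \<inter> W. inj_on (frechet_derivative \<phi> (at x)) W"
    using inj unfolding T'_def by (metis Int_iff inj_on_subset subset_UNIV)
  ultimately show "\<exists>U (W :: 'a set) T \<phi> \<psi>. openin (top_of_set E) U \<and> p \<in> U \<and>
        subspace W \<and> dim W = k \<and> open T \<and> smooth_on \<phi> T \<and>
        (\<forall>x \<in> T \<inter> W. inj_on (frechet_derivative \<phi> (at x)) W) \<and>
        homeomorphism (T \<inter> W) (M \<inter> U) \<phi> \<psi>"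
    using V(2) N(2) p assms(1) W T'
    by - (rule exI[of _ "V \<inter> N \<inter> E"], rule exI[of _ W], rule exI[of _ T'], rule exI[of _ \<phi>],
        rule exI[of _ F], auto)
qed

section \<open>Entries, linearity and continuity of matrix operations\<close>

lemma matrix_mult_nth: "(A ** B) $ i $ j = (\<Sum>k\<in>UNIV. A $ i $ k * B $ k $ j)"
  by (simp add: matrix_matrix_mult_def)

lemma transpose_nth: "transpose A $ i $ j = A $ j $ i"
  by (simp add: transpose_def)

lemma mat_nth: "mat c $ i $ j = (if i = j then c else 0)"
  by (simp add: mat_def)

lemma bounded_bilinear_matrix_mult:
  "bounded_bilinear ((**) :: real^'m^'n \<Rightarrow> real^'k^'m \<Rightarrow> real^'k^'n)"
  unfolding bilinear_conv_bounded_bilinear[symmetric] bilinear_def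
  by (auto intro!: linearI simp: matrix_matrix_mult_def vec_eq_iff sum.distrib algebra_simps sum_distrib_left)

lemma linear_transpose: "linear (transpose :: real^'m^'n \<Rightarrow> real^'n^'m)"
  by (auto intro!: linearI simp: transpose_def vec_eq_iff)

lemma bounded_linear_transpose: "bounded_linear (transpose :: real^'m^'n \<Rightarrow> real^'n^'m)"
  using linear_transpose by (simp add: linear_linear)

lemma inner_matrix: "(X :: real^'n^'m) \<bullet> Y = (\<Sum>i\<in>UNIV. \<Sum>j\<in>UNIV. X $ i $ j * Y $ i $ j)"
  by (simp add: inner_vec_def)

lemmas continuous_on_matrix_mult [continuous_intros] =
  bounded_bilinear.continuous_on[OF bounded_bilinear_matrix_mult]

lemmas continuous_on_transpose [continuous_intros] =
  bounded_linear.continuous_on[OF bounded_linear_transpose]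

lemma continuous_on_det [continuous_intros]:
  fixes f :: "'a::topological_space \<Rightarrow> real^'n^'n"
  assumes "continuous_on S f" shows "continuous_on S (\<lambda>x. det (f x))"
  unfolding det_def by (intro continuous_intros assms)

section \<open>The rotation group\<close>

lemma SO_iff: "g \<in> SO \<longleftrightarrow> transpose g ** g = mat 1 \<and> det g = 1"
  by (simp add: SO_def rotation_matrix_def orthogonal_matrix)

lemma SO_D:
  assumes "g \<in> SO"
  shows "transpose g ** g = mat 1" "g ** transpose g = mat 1" "det g = 1"
  using assms by (auto simp: SO_def rotation_matrix_def orthogonal_matrix_def)

lemma SO_one: "mat 1 \<in> SO"
  by (simp add: SO_iff)

lemma SO_mult: "g \<in> SO \<Longrightarrow> h \<in> SO \<Longrightarrow> g ** h \<in> SO"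
  by (simp add: SO_def rotation_matrix_def orthogonal_matrix_mul det_mul)

lemma SO_transpose: "g \<in> SO \<Longrightarrow> transpose g \<in> SO"
  by (simp add: SO_def rotation_matrix_def)

lemma norm_SO: "g \<in> SO \<Longrightarrow> norm (g :: real^'n^'n) = sqrt (CARD('n))"
proof -
  assume "g \<in> SO"
  then have "g \<bullet> g = trace (g ** transpose g)"
    by (simp add: inner_matrix trace_def matrix_mult_nth transpose_nth)
  then show ?thesis
    using SO_D(2)[OF \<open>g \<in> SO\<close>] by (simp add: norm_eq_sqrt_inner trace_I)
qed

lemma compact_SO: "compact (SO :: (real^'n^'n) set)"
proof -
  have "closed ({g :: real^'n^'n. transpose g ** g = mat 1} \<inter> {g. det g = 1})"
    by (intro closed_Int closed_Collect_eq continuous_intros)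
  moreover have "{g :: real^'n^'n. transpose g ** g = mat 1} \<inter> {g. det g = 1} = SO"
    by (auto simp: SO_iff)
  ultimately have "closed (SO :: (real^'n^'n) set)" by simp
  moreover have "bounded (SO :: (real^'n^'n) set)"
    unfolding bounded_iff using norm_SO by (metis order_refl)
  ultimately show ?thesis by (simp add: compact_eq_bounded_closed)
qed

lemma orbit_eq_image: "orbit A = (\<lambda>g. g ** A ** transpose g) ` SO"
  by (auto simp: orbit_def)

lemma compact_orbit: "compact (orbit A)"
  unfolding orbit_eq_image
  by (intro compact_continuous_image compact_SO continuous_intros)

lemma orbit_self: "A \<in> orbit A"
  unfolding orbit_eq_image using SO_one by (intro image_eqI[of _ _ "mat 1"]) auto

lemma orbit_conj: "B \<in> orbit A \<Longrightarrow> g \<in> SO \<Longrightarrow> g ** B ** transpose g \<in> orbit A"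
proof -
  assume "B \<in> orbit A" "g \<in> SO"
  then obtain h where h: "h \<in> SO" "B = h ** A ** transpose h" by (auto simp: orbit_eq_image)
  have "g ** B ** transpose g = (g ** h) ** A ** transpose (g ** h)"
    by (simp add: h(2) matrix_transpose_mul matrix_mul_assoc)
  then show ?thesis using SO_mult[OF \<open>g \<in> SO\<close> h(1)] by (auto simp: orbit_eq_image)
qed

lemma conj_cancel:
  assumes "g \<in> SO"
  shows "transpose g ** (g ** A ** transpose g) ** g = A" "g ** (transpose g ** A ** g) ** transpose g = A"
proof -
  have "transpose g ** (g ** A ** transpose g) ** g = (transpose g ** g) ** A ** (transpose g ** g)"
    by (simp add: matrix_mul_assoc)
  then show "transpose g ** (g ** A ** transpose g) ** g = A" by (simp add: SO_D[OF assms])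
  have "g ** (transpose g ** A ** g) ** transpose g = (g ** transpose g) ** A ** (g ** transpose g)"
    by (simp add: matrix_mul_assoc)
  then show "g ** (transpose g ** A ** g) ** transpose g = A" by (simp add: SO_D[OF assms])
qed

lemma orbit_sym: "B \<in> orbit A \<Longrightarrow> A \<in> orbit B"
proof -
  assume "B \<in> orbit A"
  then obtain h where h: "h \<in> SO" "B = h ** A ** transpose h" by (auto simp: orbit_eq_image)
  have "A = transpose h ** B ** transpose (transpose h)"
    using conj_cancel(1)[OF h(1)] h(2) by simp
  then show ?thesis unfolding orbit_def using SO_transpose[OF h(1)] by blast
qed

lemma orbit_eqI: "B \<in> orbit A \<Longrightarrow> orbit B = orbit A"
proof -
  have *: "orbit B \<subseteq> orbit A" if "B \<in> orbit A" for A B :: "real^'a^'a"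
    using that orbit_conj by (auto simp: orbit_eq_image[of B])
  assume "B \<in> orbit A" then show ?thesis using *[of B A] *[of A B] orbit_sym by blast
qed

lemma orbit_subset_Sym: "A \<in> Sym \<Longrightarrow> orbit A \<subseteq> Sym"
  by (auto simp: orbit_def Sym_def matrix_transpose_mul matrix_mul_assoc)

lemma trace_conj: "g \<in> SO \<Longrightarrow> trace (g ** A ** transpose g) = trace (A :: real^'n^'n)"
  by (metis SO_D(1) matrix_mul_assoc matrix_mul_lid trace_mul_sym)

lemma orbit_subset_hyperplane:
  assumes "A \<in> Sym"
  shows "orbit A \<subseteq> {X \<in> Sym. \<forall>Z \<in> Scal. orthogonal (X - A) Z}"
proof -
  have "orthogonal (X - A) Z" if X: "X \<in> orbit A" and Z: "Z \<in> Scal" for X Z :: "real^'a^'a"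
  proof -
    obtain c where Z: "Z = c *\<^sub>R mat 1" using Z by (auto simp: Scal_def)
    have "(X - A) \<bullet> Z = c * trace (X - A)"
      by (simp add: Z inner_matrix trace_def mat_nth if_distrib sum.delta sum_distrib_left mult.commute cong: if_cong)
    also have "trace (X - A) = 0"
      using X trace_conj by (auto simp: trace_sub orbit_eq_image)
    finally show ?thesis by (simp add: orthogonal_def)
  qed
  then show ?thesis using orbit_subset_Sym[OF assms] by auto
qed

section \<open>Plane rotations, diagonalization and connectedness\<close>

text \<open>Rows \<open>i\<close> and \<open>j\<close> are sums of two conditionals, so that the
  sums in a matrix product collapse by \<open>sum.delta\<close>.\<close>

definition plane_rot :: "'n \<Rightarrow> 'n \<Rightarrow> real \<Rightarrow> real^'n^'n" where
  "plane_rot i j t = (\<chi> a b.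
     if a = i then (if b = i then cos t else 0) + (if b = j then - sin t else 0)
     else if a = j then (if b = i then sin t else 0) + (if b = j then cos t else 0)
     else if b = a then 1 else 0)"

lemma plane_rot_mult_nth:
  assumes "i \<noteq> j"
  shows "(plane_rot i j t ** M) $ a $ b =
    (if a = i then cos t * M $ i $ b - sin t * M $ j $ b
     else if a = j then sin t * M $ i $ b + cos t * M $ j $ b else M $ a $ b)"
proof -
  have if_mult: "(if P then x else 0) * y = (if P then x * y else 0)" for P and x y :: real by simp
  show ?thesis
    by (simp add: plane_rot_def matrix_mult_nth distrib_right sum.distrib if_mult sum.delta)
qed

lemma plane_rot_add:
  assumes "i \<noteq> j" shows "plane_rot i j s ** plane_rot i j t = plane_rot i j (s + t)"
  using assms by (simp add: vec_eq_iff plane_rot_mult_nth)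
    (auto simp: plane_rot_def cos_add sin_add algebra_simps)

lemma plane_rot_0: "i \<noteq> j \<Longrightarrow> plane_rot i j 0 = mat 1"
  by (auto simp: plane_rot_def vec_eq_iff mat_nth)

lemma transpose_plane_rot: "i \<noteq> j \<Longrightarrow> transpose (plane_rot i j t) = plane_rot i j (- t)"
  by (auto simp: plane_rot_def vec_eq_iff transpose_nth)

text \<open>Orthogonality leaves determinant 1 or -1; halving the angle exhibits the determinant as
  a square.\<close>

lemma plane_rot_SO:
  assumes "i \<noteq> j" shows "plane_rot i j t \<in> SO"
proof -
  have orth: "orthogonal_matrix (plane_rot i j t)" for t
    using assms by (simp add: orthogonal_matrix transpose_plane_rot plane_rot_add plane_rot_0)
  have "det (plane_rot i j t) = det (plane_rot i j (t/2)) * det (plane_rot i j (t/2))"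
    using plane_rot_add[OF assms, of "t/2" "t/2"] by (simp add: det_mul[symmetric])
  also have "\<dots> = 1" using det_orthogonal_matrix[OF orth, of "t/2"] by auto
  finally show ?thesis using orth by (simp add: SO_def rotation_matrix_def)
qed

lemma continuous_on_plane_rot: "continuous_on S (plane_rot i j)"
  unfolding plane_rot_def
proof (intro continuous_on_vec_lambda)
  fix a b
  show "continuous_on S (\<lambda>t. if a = i then (if b = i then cos t else 0) + (if b = j then - sin t else 0)
     else if a = j then (if b = i then sin t else 0) + (if b = j then cos t else 0)
     else if b = a then 1 else 0)"
    by (cases "a = i"; cases "a = j"; cases "b = i"; cases "b = j"; simp add: continuous_intros)
qed

text \<open>The first-order condition at a maximum in \<open>t = 0\<close>, without derivatives: the
  angle of the vector \<open>(A, B)\<close> gives the value \<open>sqrt (A^2 + B^2)\<close>, which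
  exceeds \<open>A\<close> unless \<open>B = 0\<close>. The half turn gives the sign of
  \<open>A\<close>.\<close>

lemma cos_sin_max_at_0:
  fixes A B :: real
  assumes "\<And>t. A * cos t + B * sin t \<le> A"
  shows "B = 0" "A \<ge> 0"
proof -
  show "A \<ge> 0" using assms[of pi] by simp
  show "B = 0"
  proof (rule ccontr)
    assume "B \<noteq> 0"
    define r where "r = sqrt (A\<^sup>2 + B\<^sup>2)"
    have r2: "r\<^sup>2 = A\<^sup>2 + B\<^sup>2" by (simp add: r_def)
    have r: "r > 0" using \<open>B \<noteq> 0\<close> by (simp add: r_def add_nonneg_pos)
    have "(A / r)\<^sup>2 + (B / r)\<^sup>2 = 1"
      unfolding power_divide add_divide_distrib[symmetric] r2[symmetric] using r by simp
    then obtain t where "A / r = cos t" "B / r = sin t" using sincos_total_2pi by metis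
    then have "A * (A / r) + B * (B / r) \<le> A" using assms[of t] by simp
    moreover have "A * (A / r) + B * (B / r) = r"
      using r r2 by (simp add: power2_eq_square field_simps)
    ultimately have "r\<^sup>2 \<le> A\<^sup>2" using r by (simp add: power_mono)
    then show False using r2 \<open>B \<noteq> 0\<close> by simp
  qed
qed

text \<open>Distinct weights force the off-diagonal entries of a maximiser to vanish; positivity
  serves the rotation group, where \<open>d i + d j\<close> must be nonzero and two negative entries
  are excluded.\<close>

lemma ex_inj_positive_weights: "\<exists>d :: 'n::finite \<Rightarrow> real. inj d \<and> (\<forall>i. d i > 0)"
proof -
  obtain f :: "'n \<Rightarrow> nat" where "inj f" using finite_imp_inj_to_nat_seg[of "UNIV :: 'n set"] by auto
  then have "inj (\<lambda>i. real (f i) + 1)" by (auto simp: inj_def)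
  then show ?thesis by (intro exI[of _ "\<lambda>i. real (f i) + 1"]) auto
qed

lemma sum_two:
  fixes f :: "'n::finite \<Rightarrow> real"
  assumes "i \<noteq> j" "\<And>a. a \<noteq> i \<Longrightarrow> a \<noteq> j \<Longrightarrow> f a = 0"
  shows "(\<Sum>a\<in>UNIV. f a) = f i + f j"
proof -
  have "(\<Sum>a\<in>UNIV. f a) = (\<Sum>a\<in>{i, j}. f a)" by (rule sum.mono_neutral_right) (use assms in auto)
  then show ?thesis using assms(1) by simp
qed

definition diagm :: "('n \<Rightarrow> real) \<Rightarrow> real^'n^'n" where
  "diagm d = (\<chi> i j. if i = j then d i else 0)"

lemma diagm_nth: "diagm d $ i $ j = (if i = j then d i else 0)"
  by (simp add: diagm_def)

lemma Dg_iff: "X \<in> Dg \<longleftrightarrow> (\<exists>d. X = diagm d)"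
proof
  assume "X \<in> Dg" then have "X = diagm (\<lambda>i. X $ i $ i)" by (auto simp: Dg_def vec_eq_iff diagm_nth)
  then show "\<exists>d. X = diagm d" by blast
qed (auto simp: Dg_def diagm_nth)

lemma diagm_mult_left: "(diagm d ** X) $ i $ j = d i * X $ i $ j"
  by (simp add: matrix_mult_nth diagm_nth if_distribR if_distrib sum.delta cong: if_cong)

lemma diagm_mult_right: "(X ** diagm d) $ i $ j = X $ i $ j * d j"
  by (simp add: matrix_mult_nth diagm_nth if_distribR if_distrib sum.delta cong: if_cong)

lemma transpose_diagm: "transpose (diagm d) = diagm d"
  by (auto simp: vec_eq_iff transpose_nth diagm_nth)

text \<open>Maximise \<open>\<Sum>i. d i * X $ i $ i\<close> over the orbit, for distinct weights \<open>d\<close>: stationarity under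
  the rotation in the \<open>(i, j)\<close>-plane says that the \<open>(i, j)\<close> entry vanishes.\<close>

lemma orbit_meets_Dg:
  assumes "A \<in> Sym" shows "\<exists>X \<in> orbit A. X \<in> Dg"
proof -
  obtain d :: "'a \<Rightarrow> real" where d: "inj d" using ex_inj_positive_weights by blast
  define f where "f = (\<lambda>X :: real^'a^'a. \<Sum>a\<in>UNIV. d a * X $ a $ a)"
  have "continuous_on (orbit A) f" unfolding f_def by (intro continuous_intros)
  then obtain X where X: "X \<in> orbit A" and max: "\<And>Y. Y \<in> orbit A \<Longrightarrow> f Y \<le> f X"
    using continuous_attains_sup[OF compact_orbit] orbit_self by (metis empty_iff)
  have sym: "transpose X = X" using X orbit_subset_Sym[OF assms] by (auto simp: Sym_def)
  have "X $ i $ j = 0" if ij: "i \<noteq> j" for i j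
  proof -
    define P where "P = (d i - d j) * (X $ i $ i - X $ j $ j) / 2"
    define Q where "Q = (d j - d i) * X $ i $ j"
    have sym_ij: "X $ j $ i = X $ i $ j" using sym by (metis transpose_nth)
    have "P * cos t + Q * sin t \<le> P" for t
    proof -
      \<comment> \<open>Conjugation doubles the angle: the diagonal entries are quadratic in
        \<open>s\<close> and \<open>c\<close>, so rotating by \<open>t/2\<close> produces
        \<open>cos t\<close> and \<open>sin t\<close>.\<close>
      define s c where "s = sin (t/2)" and "c = cos (t/2)"
      have t: "cos t = c * c - s * s" "sin t = 2 * s * c"
        using cos_add[of "t/2" "t/2"] sin_add[of "t/2" "t/2"] by (simp_all add: s_def c_def)
      have sc: "c * c = 1 - s * s" unfolding s_def c_def
        using sin_cos_squared_add[of "t/2"] by (simp add: power2_eq_square)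
      let ?R = "plane_rot i j (t/2)"
      define Z where "Z = ?R ** X ** transpose ?R"
      \<comment> \<open>As \<open>X\<close> is symmetric, conjugation becomes two left
        multiplications, both computed by \<open>plane_rot_mult_nth\<close>.\<close>
      have Z: "Z = ?R ** transpose (?R ** X)"
        by (simp add: Z_def matrix_transpose_mul matrix_mul_assoc sym)
      have "f Z - f X = (\<Sum>a\<in>UNIV. d a * (Z $ a $ a - X $ a $ a))"
        by (simp add: f_def sum_subtractf algebra_simps)
      also have "\<dots> = d i * (Z $ i $ i - X $ i $ i) + d j * (Z $ j $ j - X $ j $ j)"
        by (rule sum_two[OF ij]) (auto simp: Z plane_rot_mult_nth[OF ij] transpose_nth)
      \<comment> \<open>The last summand vanishes by \<open>sc\<close>; with it the identity holds
        for arbitrary \<open>s\<close> and \<open>c\<close> and is plain algebra.\<close>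
      also have "\<dots> = P * cos t + Q * sin t - P + (c * c + s * s - 1) * ((d i + d j) * (X $ i $ i + X $ j $ j) / 2)"
        using ij unfolding t
        by (simp add: Z plane_rot_mult_nth[OF ij] transpose_nth s_def[symmetric] c_def[symmetric]
            sym_ij P_def Q_def) (simp add: field_simps)
      also have "\<dots> = P * cos t + Q * sin t - P" by (simp add: sc)
      finally have "f Z - f X = P * cos t + Q * sin t - P" .
      moreover have "f Z \<le> f X"
        using max orbit_conj[OF X plane_rot_SO[OF ij]] by (simp add: Z_def)
      ultimately show ?thesis by simp
    qed
    then have "Q = 0" by (rule cos_sin_max_at_0)
    then show ?thesis using d ij by (auto simp: Q_def inj_def)
  qed
  then show ?thesis using X by (auto simp: Dg_def)
qed

text \<open>The same maximisation on a connected component of the group.  At a maximiser \<open>M\<close> of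
  \<open>trace (D ** M)\<close> the matrix \<open>M ** D\<close> is symmetric, which forces \<open>M\<close> to be diagonal with
  entries \<open>\<plusminus>1\<close>; rotating by \<open>pi\<close> in a coordinate plane excludes two negative entries.\<close>

lemma connected_SO: "connected (SO :: (real^'n^'n) set)"
proof -
  obtain d :: "'n \<Rightarrow> real" where d: "inj d" "\<And>i. d i > 0" using ex_inj_positive_weights by blast
  have "connected_component SO g (mat 1)" if g: "g \<in> SO" for g :: "real^'n^'n"
  proof -
    define C where "C = connected_component_set SO g"
    define f where "f = (\<lambda>X :: real^'n^'n. \<Sum>a\<in>UNIV. d a * X $ a $ a)"
    have "closed C" unfolding C_def by (intro closed_connected_component compact_imp_closed compact_SO)
    moreover have "C \<subseteq> SO" unfolding C_def by (rule connected_component_subset)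
    ultimately have "compact C" using compact_SO by (metis compact_Int_closed inf.absorb2)
    moreover have "g \<in> C" using g by (simp add: C_def)
    moreover have "continuous_on C f" unfolding f_def by (intro continuous_intros)
    ultimately obtain M where M: "M \<in> C" and max: "\<And>Y. Y \<in> C \<Longrightarrow> f Y \<le> f M"
      using continuous_attains_sup[of C f] by blast
    have SO: "M \<in> SO" using M \<open>C \<subseteq> SO\<close> by blast
    \<comment> \<open>The rotations in one plane trace a connected set through \<open>M\<close>, so
      they vary \<open>M\<close> without leaving its component.\<close>
    have rot: "plane_rot i j t ** M \<in> C" if ij: "i \<noteq> j" for i j t
    proof -
      let ?p = "\<lambda>t. plane_rot i j t ** M"
      have "connected (range ?p)"
        by (intro connected_continuous_image continuous_intros continuous_on_plane_rot) auto
      moreover have "range ?p \<subseteq> SO" using SO_mult plane_rot_SO[OF ij] SO by blast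
      moreover have "M \<in> range ?p" using plane_rot_0[OF ij] by (intro image_eqI[of _ _ 0]) auto
      ultimately have "connected_component SO M (?p t)"
        unfolding connected_component_def by blast
      then show ?thesis using M unfolding C_def by (metis connected_component_trans mem_Collect_eq)
    qed
    have crit: "d j * M $ i $ j = d i * M $ j $ i \<and> d i * M $ i $ i + d j * M $ j $ j \<ge> 0"
      if ij: "i \<noteq> j" for i j
    proof -
      define P where "P = d i * M $ i $ i + d j * M $ j $ j"
      define Q where "Q = d j * M $ i $ j - d i * M $ j $ i"
      have "P * cos t + Q * sin t \<le> P" for t
      proof -
        define Z where "Z = plane_rot i j t ** M"
        have "f Z - f M = (\<Sum>a\<in>UNIV. d a * (Z $ a $ a - M $ a $ a))"
          by (simp add: f_def sum_subtractf algebra_simps)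
        also have "\<dots> = d i * (Z $ i $ i - M $ i $ i) + d j * (Z $ j $ j - M $ j $ j)"
          by (rule sum_two[OF ij]) (auto simp: Z_def plane_rot_mult_nth[OF ij])
        also have "\<dots> = P * cos t + Q * sin t - P"
          using ij by (simp add: Z_def plane_rot_mult_nth[OF ij] P_def Q_def algebra_simps)
        finally show ?thesis using max[OF rot[OF ij, of t]] by (simp add: Z_def)
      qed
      then have "Q = 0" "P \<ge> 0" by (rule cos_sin_max_at_0)+
      then show ?thesis by (simp add: P_def Q_def)
    qed
    have "M ** diagm d = diagm d ** transpose M"
      using crit by (auto simp: vec_eq_iff diagm_mult_left diagm_mult_right transpose_nth mult.commute)
        metis
    \<comment> \<open>Multiplying by the transpose on the left and by \<open>M\<close> on the right
      yields a second relation, \<open>eq2\<close>; both together give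
      \<open>d i^2 * M $ i $ j = d j^2 * M $ i $ j\<close>.\<close>
    then have "transpose M ** (M ** diagm d) ** M = transpose M ** (diagm d ** transpose M) ** M"
      by simp
    then have "(transpose M ** M) ** diagm d ** M = transpose M ** diagm d ** (transpose M ** M)"
      by (simp add: matrix_mul_assoc)
    then have eq2: "diagm d ** M = transpose M ** diagm d" by (simp add: SO_D[OF SO])
    have diag: "M $ i $ j = 0" if ij: "i \<noteq> j" for i j
    proof -
      have "d i * M $ i $ j = M $ j $ i * d j"
        using eq2 by (metis diagm_mult_left diagm_mult_right transpose_nth)
      then have "d i * (d i * M $ i $ j) = d j * (d j * M $ i $ j)"
        using crit[OF ij] by (simp add: mult_ac)
      then have "(d i * d i - d j * d j) * M $ i $ j = 0" by (simp add: algebra_simps)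
      moreover have "d i * d i - d j * d j = (d i - d j) * (d i + d j)" by (simp add: algebra_simps)
      moreover have "d i - d j \<noteq> 0" using d(1) ij by (auto simp: inj_def)
      moreover have "d i + d j \<noteq> 0" using d(2)[of i] d(2)[of j] by simp
      ultimately show ?thesis by simp
    qed
    have "(transpose M ** M) $ i $ i = M $ i $ i * M $ i $ i" for i
    proof -
      have "(transpose M ** M) $ i $ i = (\<Sum>k\<in>{i}. M $ k $ i * M $ k $ i)"
        unfolding matrix_mult_nth transpose_nth by (rule sum.mono_neutral_right) (use diag in auto)
      then show ?thesis by simp
    qed
    then have sq: "M $ i $ i = 1 \<or> M $ i $ i = - 1" for i
      by (simp add: SO_D[OF SO] mat_nth) (metis square_eq_1_iff)
    have one: "M $ i $ i = 1" for i
    proof (rule ccontr)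
      assume "M $ i $ i \<noteq> 1"
      then have i: "M $ i $ i = - 1" using sq by blast
      have j: "M $ j $ j = 1" if "j \<noteq> i" for j
      proof (rule ccontr)
        assume "M $ j $ j \<noteq> 1"
        then have "M $ j $ j = - 1" using sq by blast
        then show False using crit[OF that] i d(2)[of i] d(2)[of j] by simp
      qed
      \<comment> \<open>A single entry -1 is left to exclude; it would make the determinant
        -1.\<close>
      have "det M = (\<Prod>a\<in>UNIV. M $ a $ a)" by (rule det_diagonal) (use diag in auto)
      also have "\<dots> = M $ i $ i * (\<Prod>a\<in>UNIV - {i}. M $ a $ a)" by (simp add: prod.remove[of _ i])
      also have "(\<Prod>a\<in>UNIV - {i}. M $ a $ a) = 1" by (rule prod.neutral) (use j in auto)
      finally show False using SO_D(3)[OF SO] i by simp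
    qed
    have "M = mat 1" using diag one by (auto simp: vec_eq_iff mat_nth)
    then show ?thesis using M by (simp add: C_def)
  qed
  then show ?thesis unfolding connected_iff_connected_component
    by (meson connected_component_sym connected_component_trans)
qed

lemma connected_orbit: "connected (orbit A)"
  unfolding orbit_eq_image
  by (intro connected_continuous_image connected_SO continuous_intros)

section \<open>Products of linear factors in a matrix\<close>

text \<open>A monic polynomial in one matrix, encoded by its list of roots so that
  \<open>removeAll\<close> drops a factor.\<close>

primrec matpoly :: "real list \<Rightarrow> real^'n^'n \<Rightarrow> real^'n^'n" where
  "matpoly [] X = mat 1"
| "matpoly (l # ls) X = (X - mat l) ** matpoly ls X"

lemma mat_mult_left: "mat c ** X = c *\<^sub>R (X :: real^'n^'n)"
  and mat_mult_right: "X ** mat c = c *\<^sub>R (X :: real^'n^'n)"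
  by (simp_all add: vec_eq_iff matrix_mult_nth mat_nth if_distribR if_distrib sum.delta mult.commute cong: if_cong)

lemmas matrix_diff_left = bounded_bilinear.diff_left[OF bounded_bilinear_matrix_mult]
lemmas matrix_diff_right = bounded_bilinear.diff_right[OF bounded_bilinear_matrix_mult]

lemmas matrix_scaleR_left = bounded_bilinear.scaleR_left[OF bounded_bilinear_matrix_mult]
lemmas matrix_scaleR_right = bounded_bilinear.scaleR_right[OF bounded_bilinear_matrix_mult]

lemma matpoly_commute: "X ** matpoly ls X = matpoly ls X ** X"
proof (induction ls)
  case (Cons l ls)
  have "X ** ((X - mat l) ** matpoly ls X) = (X - mat l) ** (X ** matpoly ls X)"
    by (simp add: matrix_diff_left matrix_diff_right matrix_mul_assoc mat_mult_left mat_mult_right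
        matrix_scaleR_left matrix_scaleR_right)
  then show ?case using Cons by (simp add: matrix_mul_assoc)
qed simp

lemma transpose_mat: "transpose (mat c) = mat c"
  by (auto simp: vec_eq_iff transpose_nth mat_nth)

lemma transpose_matpoly:
  assumes "transpose X = X" shows "transpose (matpoly ls X) = matpoly ls X"
proof (induction ls)
  case (Cons l ls)
  have "transpose (X - mat l) = X - mat l"
    using linear_diff[OF linear_transpose, of X "mat l"] assms by (simp add: transpose_mat)
  then have "transpose (matpoly (l # ls) X) = matpoly ls X ** (X - mat l)"
    by (simp only: matpoly.simps matrix_transpose_mul Cons)
  also have "\<dots> = (X - mat l) ** matpoly ls X"
    by (simp add: matrix_diff_left matrix_diff_right mat_mult_left mat_mult_right matpoly_commute)
  finally show ?case by simp
qed (simp add: transpose_mat)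

lemma matpoly_conj:
  assumes "g \<in> SO" shows "matpoly ls (g ** X ** transpose g) = g ** matpoly ls X ** transpose g"
proof (induction ls)
  case Nil
  show ?case using SO_D(2)[OF assms] by simp
next
  case (Cons l ls)
  have "g ** X ** transpose g - mat l = g ** (X - mat l) ** transpose g"
    using SO_D(2)[OF assms]
    by (simp add: matrix_diff_left matrix_diff_right mat_mult_right matrix_scaleR_left)
      (simp add: vec_eq_iff mat_nth)
  then have "matpoly (l # ls) (g ** X ** transpose g) =
    g ** (X - mat l) ** (transpose g ** g) ** matpoly ls X ** transpose g"
    using Cons by (simp add: matrix_mul_assoc)
  then show ?case using SO_D(1)[OF assms] by (simp add: matrix_mul_assoc)
qed

lemma diagm_mult: "diagm d ** diagm e = diagm (\<lambda>i. d i * e i)"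
  by (simp add: vec_eq_iff diagm_mult_left) (simp add: diagm_nth)

lemma matpoly_diagm: "matpoly ls (diagm d) = diagm (\<lambda>i. \<Prod>l\<leftarrow>ls. d i - l)"
proof (induction ls)
  case Nil
  show ?case by (simp add: vec_eq_iff mat_nth diagm_nth)
next
  case (Cons l ls)
  have "diagm d - mat l = diagm (\<lambda>i. d i - l)" by (simp add: vec_eq_iff mat_nth diagm_nth)
  then show ?case using Cons by (simp add: diagm_mult)
qed

lemma prod_list_roots_zero_iff: "(\<Prod>l\<leftarrow>ls. (x::real) - l) = 0 \<longleftrightarrow> x \<in> set ls"
  by (auto simp: prod_list_zero_iff)

lemma Ck_on_matpoly: "Ck_on k (matpoly ls) UNIV"
proof (induction ls)
  case Nil
  show ?case by (simp add: Ck_on_const)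
next
  case (Cons l ls)
  have "Ck_on k (\<lambda>X. X + - mat l) UNIV" by (intro Ck_on_add Ck_on_ident Ck_on_const) auto
  then show ?case
    using bounded_bilinear.Ck_on[OF bounded_bilinear_matrix_mult open_UNIV _ Cons] by simp
qed

lemma continuous_on_matpoly: "continuous_on UNIV (matpoly ls)"
  using Ck_on_matpoly Ck_on_imp_continuous_on by blast

lemma bounded_linear_entry: "bounded_linear (\<lambda>X :: real^'n^'m. X $ i $ j)"
  by (rule bounded_linear_compose[OF bounded_linear_vec_nth bounded_linear_vec_nth])

lemma real_polynomial_function_matpoly: "real_polynomial_function (\<lambda>X. matpoly ls X $ i $ j)"
proof (induction ls arbitrary: i j)
  case Nil
  show ?case by (simp add: real_polynomial_function.intros(2))
next
  case (Cons l ls)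
  have "real_polynomial_function (\<lambda>X :: real^'a^'a. X $ i $ k - mat l $ i $ k)" for i k
    by (intro real_polynomial_function_diff real_polynomial_function.intros bounded_linear_entry)
  then show ?case
    unfolding matpoly.simps matrix_mult_nth
    by (intro real_polynomial_function_sum real_polynomial_function.intros(4) Cons) auto
qed

text \<open>\<open>root_deriv ls\<close> is the derivative of \<open>\<lambda>x. \<Prod>l\<leftarrow>ls. x - l\<close>.\<close>

primrec root_deriv :: "real list \<Rightarrow> real \<Rightarrow> real" where
  "root_deriv [] x = 0"
| "root_deriv (l # ls) x = (\<Prod>m\<leftarrow>ls. x - m) + (x - l) * root_deriv ls x"

text \<open>Roots listed without repetition are simple: without the factor of \<open>x\<close> the
  product no longer vanishes at \<open>x\<close>.\<close>

lemma root_deriv_nonzero: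
  assumes "distinct ls" "x \<in> set ls" shows "root_deriv ls x \<noteq> 0"
  using assms
proof (induction ls)
  case (Cons l ls)
  show ?case
  proof (cases "x = l")
    case True
    then show ?thesis using Cons.prems prod_list_roots_zero_iff[of x ls] by simp
  next
    case False
    then show ?thesis using Cons prod_list_roots_zero_iff[of x ls] by simp
  qed
qed simp

text \<open>At a diagonal matrix the derivative acts entrywise by divided differences; where
  \<open>d i = d j\<close> these become the ordinary derivative, and the product rule recursion for
  \<open>root_deriv\<close> matches that for the matrix.\<close>

lemma matpoly_has_derivative_at_diagm:
  fixes d :: "'n::finite \<Rightarrow> real"
  shows "\<exists>M'. (matpoly ls has_derivative M') (at (diagm d)) \<and>
    (\<forall>V i j. d i = d j \<longrightarrow> M' V $ i $ j = V $ i $ j * root_deriv ls (d i))"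
proof (induction ls)
  case Nil
  have "(matpoly [] has_derivative (\<lambda>V. 0 :: real^'n^'n)) (at (diagm d))" 
    unfolding matpoly.simps[abs_def] by simp
  then show ?case by (intro exI[of _ "\<lambda>V. 0"]) simp
next
  case (Cons l ls)
  then obtain M' where M': "(matpoly ls has_derivative M') (at (diagm d))"
    "\<And>V i j. d i = d j \<Longrightarrow> M' V $ i $ j = V $ i $ j * root_deriv ls (d i)" by blast
  have "((\<lambda>X. X - mat l) has_derivative (\<lambda>V. V)) (at (diagm d))"
    by (auto intro!: derivative_eq_intros)
  from bounded_bilinear.FDERIV[OF bounded_bilinear_matrix_mult this M'(1)]
  have der: "(matpoly (l # ls) has_derivative
    (\<lambda>V. (diagm d - mat l) ** M' V + V ** matpoly ls (diagm d))) (at (diagm d))"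
    unfolding matpoly.simps[abs_def] .
  have eq: "diagm d - mat l = diagm (\<lambda>i. d i - l)" by (simp add: vec_eq_iff mat_nth diagm_nth)
  have "((diagm d - mat l) ** M' V + V ** matpoly ls (diagm d)) $ i $ j =
    V $ i $ j * root_deriv (l # ls) (d i)" if "d i = d j" for V i j
    using M'(2)[OF that, of V] that
    by (simp add: eq matpoly_diagm diagm_mult_left diagm_mult_right algebra_simps)
  then show ?case using der by blast
qed

section \<open>Membership in the orbit of a diagonal matrix\<close>

text \<open>Equal multiplicities give a permutation carrying one diagonal to the other. If its
  matrix has determinant -1, reflecting one axis corrects the sign, since the reflection commutes
  with diagonal matrices.\<close>

lemma diagm_mem_orbit:
  fixes a b :: "'n::finite \<Rightarrow> real"
  assumes "\<And>l. card {i. a i = l} = card {i. b i = l}"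
  shows "diagm b \<in> orbit (diagm a)"
proof -
  have "image_mset a (mset_set UNIV) = image_mset b (mset_set UNIV)"
    by (rule multiset_eqI) (use assms in \<open>simp add: count_image_mset vimage_def Collect_conj_eq\<close>)
  then obtain p where p: "p permutes (UNIV :: 'n set)" "\<And>i. a i = b (p i)"
    using image_mset_eq_implies_permutes[of "UNIV :: 'n set" a b] by auto
  define g :: "real^'n^'n" where "g = (\<chi> i. mat 1 $ p i)"
  have g_nth: "g $ i $ j = (if p i = j then 1 else 0)" for i j by (simp add: g_def mat_nth)
  have conj: "(g ** X ** transpose g) $ i $ j = X $ p i $ p j" for X i j
    by (simp add: matrix_mult_nth g_nth transpose_nth if_distribR if_distrib sum.delta cong: if_cong)
  have pinj: "p i = p j \<longleftrightarrow> i = j" for i j using permutes_inj[OF p(1)] by (auto simp: inj_def)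
  have "g ** mat 1 ** transpose g = mat 1" by (simp only: vec_eq_iff conj) (simp add: mat_nth pinj)
  then have orth: "orthogonal_matrix g"
    using matrix_left_right_inverse[of g "transpose g"] by (simp add: orthogonal_matrix)
  have eq: "g ** diagm b ** transpose g = diagm a"
    by (simp only: vec_eq_iff conj) (simp add: diagm_nth pinj p(2))
  have "\<exists>h\<in>SO. h ** diagm b ** transpose h = diagm a"
  proof (cases "det g = 1")
    case True
    then show ?thesis using orth eq by (auto simp: SO_def rotation_matrix_def)
  next
    case False
    then have det: "det g = - 1" using det_orthogonal_matrix[OF orth] by auto
    fix k :: 'n
    define e where "e = (\<lambda>i. if i = k then - 1 else 1 :: real)"
    have e2: "e i * e i = 1" for i by (simp add: e_def)
    have ee: "diagm e ** transpose (diagm e) = mat 1"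
      by (simp add: transpose_diagm vec_eq_iff diagm_mult_left) (simp add: diagm_nth mat_nth e2)
    have "det (diagm e) = (\<Prod>i\<in>UNIV. e i)" by (subst det_diagonal) (auto simp: diagm_nth)
    also have "\<dots> = e k * (\<Prod>i\<in>UNIV - {k}. e i)" by (simp add: prod.remove[of _ k])
    also have "(\<Prod>i\<in>UNIV - {k}. e i) = 1" by (rule prod.neutral) (simp add: e_def)
    finally have "det (g ** diagm e) = 1" by (simp add: det_mul det e_def)
    moreover have "orthogonal_matrix (diagm e)"
      using ee by (simp add: orthogonal_matrix transpose_diagm)
    ultimately have "g ** diagm e \<in> SO"
      using orthogonal_matrix_mul[OF orth] by (simp add: SO_def rotation_matrix_def)
    moreover have "diagm e ** diagm b ** transpose (diagm e) = diagm b"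
      by (simp add: transpose_diagm vec_eq_iff diagm_mult_left diagm_mult_right)
        (simp add: diagm_nth mult_ac e2 e_def)
    then have "(g ** diagm e) ** diagm b ** transpose (g ** diagm e) = diagm a"
      using eq by (metis matrix_mul_assoc matrix_transpose_mul)
    ultimately show ?thesis by blast
  qed
  then have "diagm a \<in> orbit (diagm b)" unfolding orbit_def by (simp add: eq_commute) metis
  then show ?thesis by (rule orbit_sym)
qed

text \<open>A diagonal entry other than \<open>l\<close> is still a root of the shortened product
  and contributes 0, so the trace counts the multiplicity of \<open>l\<close> up to a nonzero
  factor.\<close>

lemma trace_matpoly_diagm:
  fixes b :: "'n::finite \<Rightarrow> real"
  assumes "range b \<subseteq> set ls"
  shows "trace (matpoly (removeAll l ls) (diagm b)) =
    real (card {i. b i = l}) * (\<Prod>m\<leftarrow>removeAll l ls. l - m)"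
proof -
  have "(\<Prod>m\<leftarrow>removeAll l ls. b i - m) = (if b i = l then (\<Prod>m\<leftarrow>removeAll l ls. l - m) else 0)" for i
    using assms prod_list_roots_zero_iff[of "b i" "removeAll l ls"] by auto
  then show ?thesis
    by (simp add: matpoly_diagm trace_def diagm_nth sum.If_cases)
qed

lemma matpoly_zero_iff_diagm: "matpoly ls (diagm b) = 0 \<longleftrightarrow> range b \<subseteq> set ls"
  by (auto simp: matpoly_diagm vec_eq_iff diagm_nth prod_list_roots_zero_iff)

lemma matpoly_orbit:
  assumes "X \<in> orbit A"
  shows "matpoly ls X = 0 \<longleftrightarrow> matpoly ls A = 0" "trace (matpoly ls X) = trace (matpoly ls A)"
proof -
  obtain g where g: "g \<in> SO" "X = g ** A ** transpose g" using assms by (auto simp: orbit_def)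
  have eq: "matpoly ls X = g ** matpoly ls A ** transpose g" by (simp add: g matpoly_conj)
  then show "trace (matpoly ls X) = trace (matpoly ls A)" using trace_conj[OF g(1)] by simp
  show "matpoly ls X = 0 \<longleftrightarrow> matpoly ls A = 0"
    using eq conj_cancel(1)[OF g(1), of "matpoly ls A"] by auto
qed

text \<open>The trace condition is an inequality because the traces are integer multiples of the
  right-hand side: being close already forces the multiplicities to agree.\<close>

lemma mem_orbit_diagmI:
  fixes a :: "'n::finite \<Rightarrow> real"
  assumes "X \<in> Sym" "set ls = range a" "matpoly ls X = 0"
    and tr: "\<And>l. l \<in> set ls \<Longrightarrow> \<bar>trace (matpoly (removeAll l ls) X) -
      trace (matpoly (removeAll l ls) (diagm a))\<bar> < \<bar>\<Prod>m\<leftarrow>removeAll l ls. l - m\<bar>"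
  shows "X \<in> orbit (diagm a)"
proof -
  obtain b where b: "diagm b \<in> orbit X" using orbit_meets_Dg[OF assms(1)] by (auto simp: Dg_iff)
  then have rb: "range b \<subseteq> set ls" using matpoly_orbit(1) assms(3) matpoly_zero_iff_diagm by metis
  have "card {i. a i = l} = card {i. b i = l}" for l
  proof (cases "l \<in> set ls")
    case True
    define c where "c = (\<Prod>m\<leftarrow>removeAll l ls. l - m)"
    have "\<bar>real (card {i. b i = l}) * c - real (card {i. a i = l}) * c\<bar> < \<bar>c\<bar>"
      using tr[OF True] matpoly_orbit(2)[OF b] trace_matpoly_diagm[OF rb, of l]
        trace_matpoly_diagm[of a ls l] assms(2) by (simp add: c_def)
    then have "\<bar>real (card {i. b i = l}) - real (card {i. a i = l})\<bar> * \<bar>c\<bar> < 1 * \<bar>c\<bar>"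
      by (simp add: left_diff_distrib[symmetric] abs_mult)
    then have "\<bar>real (card {i. b i = l}) - real (card {i. a i = l})\<bar> < 1"
      by (rule mult_right_less_imp_less) simp
    then show ?thesis by linarith
  next
    case False
    then have "{i. a i = l} = {}" "{i. b i = l} = {}" using rb assms(2) by auto
    then show ?thesis by simp
  qed
  then have "diagm b \<in> orbit (diagm a)" by (rule diagm_mem_orbit)
  then show ?thesis using orbit_sym[OF b] orbit_eqI by blast
qed

lemma algebraic_surface_orbit:
  fixes A :: "real^'n^'n"
  assumes "A \<in> Sym" shows "algebraic_surface (orbit A)"
proof -
  obtain a where a: "diagm a \<in> orbit A" using orbit_meets_Dg[OF assms] by (auto simp: Dg_iff)
  have orb: "orbit A = orbit (diagm a)" using orbit_eqI[OF a] by simp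
  obtain ls where ls: "set ls = range a" using finite_list[of "range a"] by auto
  \<comment> \<open>The entries of the product restrict the eigenvalues to \<open>range a\<close>;
    one trace per eigenvalue fixes its multiplicity.\<close>
  define P where "P = (\<lambda>(i, j) X. matpoly ls X $ i $ j) ` (UNIV :: ('n \<times> 'n) set) \<union>
    (\<lambda>l X. trace (matpoly (removeAll l ls) X) - trace (matpoly (removeAll l ls) (diagm a))) ` set ls"
  have "real_polynomial_function (\<lambda>X :: real^'n^'n. trace (matpoly ls X))" for ls
    unfolding trace_def by (intro real_polynomial_function_sum real_polynomial_function_matpoly) auto
  then have "\<forall>f\<in>P. real_polynomial_function f"
    by (auto simp: P_def intro!: real_polynomial_function_matpoly real_polynomial_function_diff)
  moreover have "finite P" by (auto simp: P_def)
  moreover have "orbit A = {X \<in> Sym. \<forall>f\<in>P. f X = 0}"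
  proof (intro equalityI subsetI)
    fix X assume X: "X \<in> orbit A"
    then have "X \<in> Sym" using orbit_subset_Sym[OF assms] by blast
    moreover have "matpoly ls X = 0"
      using X matpoly_orbit(1) matpoly_zero_iff_diagm ls unfolding orb by blast
    ultimately show "X \<in> {X \<in> Sym. \<forall>f\<in>P. f X = 0}"
      using matpoly_orbit(2)[OF X[unfolded orb]] by (auto simp: P_def)
  next
    fix X assume X: "X \<in> {X \<in> Sym. \<forall>f\<in>P. f X = 0}"
    have "matpoly ls X $ i $ j = 0" for i j
    proof -
      have "(\<lambda>X. matpoly ls X $ i $ j) \<in> P"
        unfolding P_def by (rule UnI1, rule image_eqI[of _ _ "(i, j)"]) auto
      then show ?thesis using X by auto
    qed
    then have "matpoly ls X = 0" by (simp add: vec_eq_iff)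
    moreover have "\<bar>trace (matpoly (removeAll l ls) X) - trace (matpoly (removeAll l ls) (diagm a))\<bar>
        < \<bar>\<Prod>m\<leftarrow>removeAll l ls. l - m\<bar>" if "l \<in> set ls" for l
    proof -
      have "(\<lambda>X. trace (matpoly (removeAll l ls) X) - trace (matpoly (removeAll l ls) (diagm a))) \<in> P"
        using that by (auto simp: P_def)
      then have "trace (matpoly (removeAll l ls) X) - trace (matpoly (removeAll l ls) (diagm a)) = 0"
        using X by auto
      then show ?thesis using prod_list_roots_zero_iff[of l "removeAll l ls"] by simp
    qed
    ultimately show "X \<in> orbit A"
      unfolding orb using X ls by (intro mem_orbit_diagmI) auto
  qed
  ultimately show ?thesis unfolding algebraic_surface_def by blast
qed

section \<open>Orthogonality to the diagonal matrices\<close>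

lemma tangent_space_orbit_diagonal_zero:
  fixes a :: "'n::finite \<Rightarrow> real"
  assumes "diagm a \<in> orbit A" "V \<in> tangent_space (orbit A) (diagm a)"
  shows "V $ i $ i = 0"
proof -
  have orb: "orbit A = orbit (diagm a)" using orbit_eqI[OF assms(1)] by simp
  obtain c e where V: "V = vector_derivative c (at 0)" and "e > 0" and c: "smooth_on c {-e<..<e}"
    "c ` {-e<..<e} \<subseteq> orbit A" "c 0 = diagm a"
    using assms(2) by (auto simp: tangent_space_def)
  have "Ck_on (Suc 0) c {-e<..<e}" using c(1) by (simp only: smooth_on_def)
  then have "c differentiable (at 0)" using \<open>e > 0\<close> by simp
  then have der: "(c has_vector_derivative V) (at 0)"
    using V vector_derivative_works by blast
  obtain ls where ls: "set ls = range a" using finite_list[of "range a"] by auto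
  define l rs where "l = a i" and "rs = removeAll l ls"
  define Q where "Q = (\<lambda>t. matpoly rs (c t))"
  \<comment> \<open>This is the (i, i) entry of \<open>(c t - diagm a) ** Q t\<close>; its first
    factor vanishes at 0, so \<open>Q\<close> only has to be continuous there.\<close>
  define h where "h = (\<lambda>t. \<Sum>k\<in>UNIV. Q t $ k $ i *\<^sub>R (c t - diagm a) $ i $ k)"
  have "isCont c 0" using der has_vector_derivative_continuous by blast
  then have "isCont Q 0"
    unfolding Q_def using continuous_on_matpoly
    by (auto intro!: isCont_o2[of 0 c] simp: continuous_on_eq_continuous_at)
  then have contQ: "isCont (\<lambda>t. Q t $ k $ j) 0" for k j by (intro continuous_intros)
  have "((\<lambda>t. Q t $ k $ i *\<^sub>R (c t - diagm a) $ i $ k) has_derivative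
      (\<lambda>u. Q 0 $ k $ i *\<^sub>R (u *\<^sub>R V) $ i $ k)) (at 0)" for k
  proof (rule has_derivative_scaleR_at_zero[OF _ _ contQ])
    have "((\<lambda>t. c t - diagm a) has_derivative (\<lambda>u. u *\<^sub>R V)) (at 0)"
      using der by (auto simp: has_vector_derivative_def intro!: derivative_eq_intros)
    then show "((\<lambda>t. (c t - diagm a) $ i $ k) has_derivative (\<lambda>u. (u *\<^sub>R V) $ i $ k)) (at 0)"
      by (rule bounded_linear.has_derivative[OF bounded_linear_entry])
  qed (simp add: c(3))
  then have dh: "(h has_derivative (\<lambda>u. \<Sum>k\<in>UNIV. Q 0 $ k $ i *\<^sub>R (u *\<^sub>R V) $ i $ k)) (at 0)"
    unfolding h_def by (rule has_derivative_sum)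
  have h0: "h t = 0" if "t \<in> {-e<..<e}" for t
  proof -
    have ct: "c t \<in> orbit (diagm a)" using c(2) that orb by blast
    have "range a \<subseteq> set (l # rs)" using ls by (auto simp: rs_def)
    then have "matpoly (l # rs) (c t) = 0"
      using matpoly_orbit(1)[OF ct] matpoly_zero_iff_diagm by blast
    then have "((c t - mat l) ** Q t) $ i $ i = 0" by (simp add: Q_def)
    \<comment> \<open>Row \<open>i\<close> of \<open>diagm a - mat l\<close> is zero because
      \<open>l = a i\<close>, so \<open>mat l\<close> may be exchanged for \<open>diagm a\<close> in
      this entry.\<close>
    moreover have "((diagm a - mat l) ** Q t) $ i $ i = 0"
      by (simp add: matrix_diff_left mat_mult_left diagm_mult_left l_def)
    moreover have "(c t - diagm a) ** Q t = (c t - mat l) ** Q t - (diagm a - mat l) ** Q t"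
      by (simp add: matrix_diff_left)
    ultimately have "((c t - diagm a) ** Q t) $ i $ i = 0" by simp
    then show ?thesis by (simp add: h_def matrix_mult_nth mult.commute)
  qed
  have "(h has_derivative (\<lambda>u. 0)) (at 0)"
    by (rule has_derivative_transform_within_open[of "\<lambda>t. 0" _ _ _ "{-e<..<e}"]) (use \<open>e > 0\<close> h0 in auto)
  then have "(\<lambda>u. \<Sum>k\<in>UNIV. Q 0 $ k $ i *\<^sub>R (u *\<^sub>R V) $ i $ k) = (\<lambda>u. 0)"
    using dh has_derivative_unique by blast
  from fun_cong[OF this, of 1] have "(\<Sum>k\<in>UNIV. Q 0 $ k $ i * V $ i $ k) = 0" by simp
  then have "(V ** Q 0) $ i $ i = 0" by (simp add: matrix_mult_nth mult.commute)
  then have "V $ i $ i * (\<Prod>m\<leftarrow>rs. l - m) = 0"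
    by (simp add: Q_def c(3) matpoly_diagm diagm_mult_right l_def)
  moreover have "(\<Prod>m\<leftarrow>rs. l - m) \<noteq> 0"
    using prod_list_roots_zero_iff[of l rs] by (simp add: rs_def)
  ultimately show ?thesis by simp
qed

lemma orbit_intersects_Dg_orthogonally:
  fixes A :: "real^'n^'n"
  assumes "A \<in> Sym" shows "intersects_orthogonally (orbit A) Dg"
  unfolding intersects_orthogonally_def
proof (intro conjI ballI)
  show "orbit A \<inter> Dg \<noteq> {}" using orbit_meets_Dg[OF assms] by blast
  fix X V Y :: "real^'n^'n" assume X: "X \<in> orbit A \<inter> Dg" and V: "V \<in> tangent_space (orbit A) X" and Y: "Y \<in> Dg"
  obtain a where a: "X = diagm a" using X by (auto simp: Dg_iff)
  have "V $ i $ i = 0" for i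
    using tangent_space_orbit_diagonal_zero X V unfolding a by blast
  then have "V $ i $ j * Y $ i $ j = 0" for i j using Y by (cases "i = j") (auto simp: Dg_def)
  then show "orthogonal V Y" unfolding orthogonal_def inner_matrix by (intro sum.neutral ballI)
qed

section \<open>Dimension of spaces of symmetric and skew matrices\<close>

text \<open>With \<open>s = 1\<close> the symmetric and with \<open>s = - 1\<close> the skew
  matrices supported on \<open>Q\<close>: the model spaces for the orbits and for the rotation
  group.\<close>

definition signed_space :: "real \<Rightarrow> ('n \<times> 'n) set \<Rightarrow> (real^'n^'n) set" where
  "signed_space s Q = {w. (\<forall>i j. w $ j $ i = s * w $ i $ j) \<and> (\<forall>i j. (i, j) \<notin> Q \<longrightarrow> w $ i $ j = 0)}"

lemma signed_spaceD:
  assumes "w \<in> signed_space s Q"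
  shows "w $ j $ i = s * w $ i $ j" and "(i, j) \<notin> Q \<Longrightarrow> w $ i $ j = 0"
  using assms unfolding signed_space_def by blast+

lemma subspace_signed_space: "subspace (signed_space s Q)"
proof (rule subspaceI)
  show "0 \<in> signed_space s Q" by (simp add: signed_space_def)
next
  fix v w assume v: "v \<in> signed_space s Q" and w: "w \<in> signed_space s Q"
  have "(v + w) $ j $ i = s * (v + w) $ i $ j" for i j
    using signed_spaceD(1)[OF v, of j i] signed_spaceD(1)[OF w, of j i] by (simp add: distrib_left)
  moreover have "(v + w) $ i $ j = 0" if "(i, j) \<notin> Q" for i j
    using signed_spaceD(2)[OF v that] signed_spaceD(2)[OF w that] by simp
  ultimately show "v + w \<in> signed_space s Q" unfolding signed_space_def by blast
next
  fix c v assume v: "v \<in> signed_space s Q"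
  have "(c *\<^sub>R v) $ j $ i = s * (c *\<^sub>R v) $ i $ j" for i j
    using signed_spaceD(1)[OF v, of j i] by simp
  moreover have "(c *\<^sub>R v) $ i $ j = 0" if "(i, j) \<notin> Q" for i j
    using signed_spaceD(2)[OF v that] by simp
  ultimately show "c *\<^sub>R v \<in> signed_space s Q" unfolding signed_space_def by blast
qed

text \<open>One entry of each pair \<open>(i, j)\<close>, \<open>(j, i)\<close> in \<open>Q\<close>
  is free and determines the other: \<open>T\<close> maps the coordinate subspace of the free
  entries isomorphically onto the space.\<close>

lemma dim_signed_space:
  fixes Q :: "('n::finite \<times> 'n) set"
  assumes s: "s * s = 1" and irrefl: "\<And>i. (i, i) \<notin> Q" and sym: "\<And>i j. (i, j) \<in> Q \<Longrightarrow> (j, i) \<in> Q"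
  shows "dim (signed_space s Q) = card Q div 2"
proof -
  obtain f :: "'n \<Rightarrow> nat" where f: "inj f" using finite_imp_inj_to_nat_seg[of "UNIV :: 'n set"] by auto
  \<comment> \<open>An injective numbering of the indices selects one orientation of each
    pair.\<close>
  define H where "H = {(i, j) \<in> Q. f i < f j}"
  have H: "(i, j) \<in> H \<Longrightarrow> (j, i) \<notin> H" for i j by (auto simp: H_def)
  have QH: "(i, j) \<in> Q \<longleftrightarrow> (i, j) \<in> H \<or> (j, i) \<in> H" for i j
    using irrefl sym f unfolding H_def inj_def by (auto simp: not_less) (metis le_antisym not_less)
  have "Q = H \<union> prod.swap ` H" using QH by (auto simp: image_iff) force
  moreover have "H \<inter> prod.swap ` H = {}" using H by auto
  moreover have "card (prod.swap ` H) = card H" by (intro card_image) simp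
  ultimately have cardQ: "card Q = 2 * card H" by (simp add: card_Un_disjoint)
  define e :: "'n \<times> 'n \<Rightarrow> real^'n^'n" where "e = (\<lambda>(i, j). axis i (axis j 1))"
  have inner_e: "x \<bullet> e (i, j) = x $ i $ j" for x i j by (simp add: e_def inner_axis)
  have eB: "range e = Basis" by (auto simp: e_def Basis_vec_def)
  have inj_e: "inj e" by (auto simp: inj_def e_def axis_eq_axis)
  define S where "S = {x :: real^'n^'n. \<forall>i j. (i, j) \<notin> H \<longrightarrow> x $ i $ j = 0}"
  have "S = {x. \<forall>b\<in>Basis. b \<notin> e ` H \<longrightarrow> x \<bullet> b = 0}"
    unfolding S_def eB[symmetric] using inj_e by (auto simp: inner_e inj_image_mem_iff)
  moreover have "dim {x :: real^'n^'n. \<forall>b\<in>Basis. b \<notin> e ` H \<longrightarrow> x \<bullet> b = 0} = card (e ` H)"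
    by (rule dim_substandard) (use eB in auto)
  ultimately have dimS: "dim S = card H" using inj_e by (simp add: card_image inj_on_subset)
  have subS: "subspace S" unfolding S_def subspace_def by auto
  define T where "T = (\<lambda>x :: real^'n^'n. x + s *\<^sub>R transpose x)"
  have T_nth: "T x $ i $ j = x $ i $ j + s * x $ j $ i" for x i j by (simp add: T_def transpose_nth)
  have linT: "linear T" by (auto intro!: linearI simp: vec_eq_iff T_nth algebra_simps)
  have "inj_on T S"
  proof (subst linear_inj_on_iff_eq_0[OF linT subS], intro ballI impI)
    fix x assume x: "x \<in> S" and T0: "T x = 0"
    have "x $ i $ j = 0" for i j
    proof (cases "(i, j) \<in> H")
      case True
      then have "x $ j $ i = 0" using H x by (auto simp: S_def)
      moreover have "T x $ i $ j = 0" using T0 by simp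
      ultimately show ?thesis by (simp add: T_nth)
    qed (use x in \<open>auto simp: S_def\<close>)
    then show "x = 0" by (simp add: vec_eq_iff)
  qed
  then have "dim (T ` S) = dim S"
    using subS by (intro dim_image_eq[OF linT]) (metis span_eq_iff)
  moreover have "T ` S = signed_space s Q"
  proof (intro equalityI subsetI)
    fix w assume "w \<in> T ` S"
    then obtain x where x: "x \<in> S" "w = T x" by blast
    have "T x $ j $ i = s * T x $ i $ j" for i j
    proof -
      have "s * (x $ i $ j + s * x $ j $ i) = s * x $ i $ j + (s * s) * x $ j $ i"
        by (simp add: algebra_simps)
      then show ?thesis by (simp add: T_nth s)
    qed
    moreover have "T x $ i $ j = 0" if "(i, j) \<notin> Q" for i j
    proof -
      have "(i, j) \<notin> H" "(j, i) \<notin> H" using QH that by blast+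
      then show ?thesis using x(1) by (simp add: S_def T_nth)
    qed
    ultimately show "w \<in> signed_space s Q"
      unfolding signed_space_def x(2) by blast
  next
    fix w assume w: "w \<in> signed_space s Q"
    define x :: "real^'n^'n" where "x = (\<chi> i j. if (i, j) \<in> H then w $ i $ j else 0)"
    have "x \<in> S" by (auto simp: S_def x_def)
    moreover have "w $ i $ j = T x $ i $ j" for i j
    proof -
      have sw: "w $ i $ j = s * w $ j $ i" by (rule signed_spaceD(1)[OF w])
      consider "(i, j) \<in> H" "(j, i) \<notin> H" | "(i, j) \<notin> H" "(j, i) \<in> H" | "(i, j) \<notin> Q" "(i, j) \<notin> H" "(j, i) \<notin> H"
        using QH H by blast
      then show ?thesis
      proof cases
        case 3
        then have "w $ i $ j = 0" using signed_spaceD(2)[OF w] by blast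
        then show ?thesis using 3 by (simp add: T_nth x_def)
      qed (simp_all add: T_nth x_def sw)
    qed
    then have "w = T x" by (simp add: vec_eq_iff)
    ultimately show "w \<in> T ` S" by blast
  qed
  ultimately show ?thesis using dimS cardQ by simp
qed

lemma card_off_diagonal: "card {(i :: 'n::finite, j). i \<noteq> j} = CARD('n) * (CARD('n) - 1)"
proof -
  have "{(i :: 'n, j). i \<noteq> j} = (SIGMA i:UNIV. UNIV - {i})" by auto
  then have "card {(i :: 'n, j). i \<noteq> j} = card (SIGMA i:(UNIV :: 'n set). UNIV - {i})" by (rule arg_cong)
  also have "\<dots> = (\<Sum>i\<in>(UNIV :: 'n set). card (UNIV - {i}))" by (rule card_SigmaI) auto
  also have "\<dots> = (\<Sum>i\<in>(UNIV :: 'n set). CARD('n) - 1)" by (intro sum.cong refl card_Diff_singleton) auto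
  finally show ?thesis by simp
qed

section \<open>The rotation group as a submanifold\<close>

lemma linear_matrix_mult_left: "linear (\<lambda>X :: real^'n^'n. (A :: real^'n^'n) ** X)"
  using bounded_bilinear.bounded_linear_right[OF bounded_bilinear_matrix_mult] by (simp add: linear_linear)

lemma linear_matrix_mult_right: "linear (\<lambda>X :: real^'n^'n. X ** (A :: real^'n^'n))"
  using bounded_bilinear.bounded_linear_left[OF bounded_bilinear_matrix_mult] by (simp add: linear_linear)

lemma injI_linear_kernel:
  assumes "linear f" "\<And>v. f v = 0 \<Longrightarrow> v = 0" shows "inj f"
  using assms by (simp add: linear_injective_0)

text \<open>The chart at \<open>g\<close> inverts a map whose symmetric part is the defining equation of the
  orthogonal group and whose skew part is a coordinate on the Lie algebra.\<close>

lemma smooth_submanifold_SO: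
  "smooth_submanifold UNIV (CARD('n) * (CARD('n) - 1) div 2) (SO :: (real^'n^'n) set)"
proof (rule smooth_submanifoldI_local_diffeo)
  fix g :: "real^'n^'n" assume g: "g \<in> SO"
  define L where "L = (\<lambda>X :: real^'n^'n. transpose g ** X)"
  define F where "F = (\<lambda>X. (transpose (L X) ** L X + (- mat 1)) + (L X + (- 1) *\<^sub>R transpose (L X)))"
  have blL: "bounded_linear L" unfolding L_def using linear_matrix_mult_left by (simp add: linear_linear)
  have bls: "bounded_linear (\<lambda>X :: real^'n^'n. (- 1) *\<^sub>R X)" by (rule bounded_linear_scaleR_right)
  have "Ck_on k F UNIV" for k
    unfolding F_def
    by (intro Ck_on_add bounded_bilinear.Ck_on[OF bounded_bilinear_matrix_mult] Ck_on_const Ck_on_ident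
        Ck_on_bounded_linear[OF bounded_linear_transpose] Ck_on_bounded_linear[OF blL]
        Ck_on_bounded_linear[OF bls] open_UNIV)
  then have "smooth_on F UNIV" by (simp add: smooth_on_def)
  moreover have "inj (frechet_derivative F (at g))"
  proof -
    have dL: "(L has_derivative L) (at g)" using blL by (rule bounded_linear_imp_has_derivative)
    have dLt: "((\<lambda>X. transpose (L X)) has_derivative (\<lambda>V. transpose (L V))) (at g)"
      by (rule bounded_linear.has_derivative[OF bounded_linear_transpose dL])
    have Lg: "L g = mat 1" using SO_D(1)[OF g] by (simp add: L_def)
    have "(F has_derivative (\<lambda>V. (transpose (L g) ** L V + transpose (L V) ** L g + 0) +
        (L V + (- 1) *\<^sub>R transpose (L V)))) (at g)"
      unfolding F_def
      by (intro has_derivative_add bounded_bilinear.FDERIV[OF bounded_bilinear_matrix_mult]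
          has_derivative_const bounded_linear.has_derivative[OF bls] dL dLt)
    \<comment> \<open>As \<open>L g = mat 1\<close>, the two halves of \<open>F\<close> contribute
      \<open>L V + transpose (L V)\<close> and \<open>L V - transpose (L V)\<close>.\<close>
    moreover have "(\<lambda>V. (transpose (L g) ** L V + transpose (L V) ** L g + 0) +
        (L V + (- 1) *\<^sub>R transpose (L V))) = (\<lambda>V. 2 *\<^sub>R L V)"
      by (simp add: Lg transpose_mat scaleR_2 algebra_simps)
    ultimately have "(F has_derivative (\<lambda>V. 2 *\<^sub>R L V)) (at g)" by simp
    then have D: "frechet_derivative F (at g) = (\<lambda>V. 2 *\<^sub>R L V)" using frechet_derivative_at by metis
    have "V = 0" if "2 *\<^sub>R L V = 0" for V
    proof -
      have "g ** L V = 0" using that by simp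
      then show ?thesis using SO_D(2)[OF g] by (simp add: L_def matrix_mul_assoc)
    qed
    moreover have "linear (\<lambda>V. 2 *\<^sub>R L V)"
      using bounded_linear_const_scaleR[OF blL] by (simp add: linear_linear)
    ultimately show ?thesis unfolding D by (intro injI_linear_kernel)
  qed
  \<comment> \<open>Where the determinant is positive, being orthogonal already means being a
    rotation.\<close>
  moreover have "X \<in> SO \<longleftrightarrow> F X \<in> signed_space (- 1) {(i, j). i \<noteq> j}" if "det X > 0" for X
  proof -
    have LL: "transpose (L X) ** L X = transpose X ** X"
      unfolding L_def matrix_transpose_mul transpose_transpose
      by (metis SO_D(2)[OF g] matrix_mul_assoc matrix_mul_lid)
    have symXX: "transpose (transpose X ** X) = transpose X ** X" by (simp add: matrix_transpose_mul)
    \<comment> \<open>Adding the transposed entry cancels the skew part, so skewness of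
      \<open>F X\<close> is exactly the equation of the orthogonal group.\<close>
    have "F X $ j $ i + F X $ i $ j = 2 * ((transpose X ** X) $ i $ j - mat 1 $ i $ j)" for i j
    proof -
      have "(transpose X ** X) $ j $ i = (transpose X ** X) $ i $ j" using symXX by (metis transpose_nth)
      then show ?thesis unfolding F_def LL by (simp add: transpose_nth mat_nth)
    qed
    then have *: "F X $ j $ i = - F X $ i $ j \<longleftrightarrow> (transpose X ** X) $ i $ j = mat 1 $ i $ j" for i j
      by (smt (verit, best))
    have "F X \<in> signed_space (- 1) {(i, j). i \<noteq> j} \<longleftrightarrow> (\<forall>i j. F X $ j $ i = - F X $ i $ j)"
    proof
      assume anti: "\<forall>i j. F X $ j $ i = - F X $ i $ j"
      have "F X $ i $ i = 0" for i using anti[rule_format, of i i] by simp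
      moreover have "F X $ j $ i = - 1 * F X $ i $ j" for i j using anti by (metis mult_minus1)
      ultimately show "F X \<in> signed_space (- 1) {(i, j). i \<noteq> j}"
        unfolding signed_space_def by blast
    next
      assume "F X \<in> signed_space (- 1) {(i, j). i \<noteq> j}"
      then show "\<forall>i j. F X $ j $ i = - F X $ i $ j"
        using signed_spaceD(1) by (metis mult_minus1)
    qed
    also have "\<dots> \<longleftrightarrow> transpose X ** X = mat 1" by (simp add: * vec_eq_iff)
    also have "\<dots> \<longleftrightarrow> X \<in> SO"
      using that det_orthogonal_matrix[of X] by (auto simp: SO_iff orthogonal_matrix)
    finally show ?thesis by blast
  qed
  moreover have "open {X :: real^'n^'n. det X > 0}"
    by (intro open_Collect_less continuous_intros)
  moreover have "dim (signed_space (- 1) {(i :: 'n, j). i \<noteq> j}) = CARD('n) * (CARD('n) - 1) div 2"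
    by (subst dim_signed_space) (auto simp: card_off_diagonal)
  ultimately show "\<exists>(F :: real^'n^'n \<Rightarrow> real^'n^'n) W N. smooth_on F UNIV \<and>
      inj (frechet_derivative F (at g)) \<and> subspace W \<and> dim W = CARD('n) * (CARD('n) - 1) div 2 \<and>
      open N \<and> g \<in> N \<and> (\<forall>X\<in>N. X \<in> SO \<longleftrightarrow> F X \<in> W)"
    using subspace_signed_space SO_D(3)[OF g]
    by (intro exI[of _ F] exI[of _ "signed_space (- 1) {(i, j). i \<noteq> j}"] exI[of _ "{X. det X > 0}"]) auto
qed simp

section \<open>Orbits as submanifolds\<close>

lemma ex_gap:
  fixes a :: "'n::finite \<Rightarrow> real"
  shows "\<exists>\<delta>>0. \<forall>i j. a i \<noteq> a j \<longrightarrow> \<delta> \<le> \<bar>a i - a j\<bar>"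
proof -
  \<comment> \<open>The inserted 1 covers a constant \<open>a\<close>, for which there are no
    gaps.\<close>
  let ?S = "insert 1 ((\<lambda>(i, j). \<bar>a i - a j\<bar>) ` {(i, j). a i \<noteq> a j})"
  have "0 < Min ?S" by (subst Min_gr_iff) auto
  moreover have "Min ?S \<le> \<bar>a i - a j\<bar>" if "a i \<noteq> a j" for i j
    by (rule Min_le) (use that in \<open>auto intro!: image_eqI[of _ _ "(i, j)"]\<close>)
  ultimately show ?thesis by blast
qed

text \<open>A matrix commuting with a small perturbation of \<open>diagm a\<close> and vanishing on the blocks of
  equal entries is zero: compare both sides of the commutation relation at an entry of maximal
  modulus.\<close>

lemma commuting_block_zero:
  fixes a :: "'n::finite \<Rightarrow> real" and M Y :: "real^'n^'n" and \<delta> \<epsilon> :: real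
  assumes comm: "Y ** M = M ** Y" and block: "\<And>i j. a i = a j \<Longrightarrow> M $ i $ j = 0"
    and gap: "\<And>i j. a i \<noteq> a j \<Longrightarrow> \<delta> \<le> \<bar>a i - a j\<bar>"
    and close: "\<And>i j. \<bar>(Y - diagm a) $ i $ j\<bar> \<le> \<epsilon>" and small: "2 * CARD('n) * \<epsilon> < \<delta>"
  shows "M = 0"
proof (rule ccontr)
  assume "M \<noteq> 0"
  define Z where "Z = Y - diagm a"
  let ?S = "(\<lambda>(i, j). \<bar>M $ i $ j\<bar>) ` UNIV"
  have "Max ?S \<in> ?S" by (rule Max_in) auto
  then obtain p where "Max ?S = (case p of (i, j) \<Rightarrow> \<bar>M $ i $ j\<bar>)" by blast
  then obtain i j where ij: "Max ?S = \<bar>M $ i $ j\<bar>" by (cases p) simp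
  define \<mu> where "\<mu> = \<bar>M $ i $ j\<bar>"
  have le: "\<bar>M $ k $ l\<bar> \<le> \<mu>" for k l
    unfolding \<mu>_def ij[symmetric] by (rule Max_ge) (auto intro!: image_eqI[of _ _ "(k, l)"])
  have "\<mu> > 0"
  proof (rule ccontr)
    assume "\<not> \<mu> > 0"
    then have "M $ k $ l = 0" for k l using le[of k l] by linarith
    then show False using \<open>M \<noteq> 0\<close> by (simp add: vec_eq_iff)
  qed
  then have "a i \<noteq> a j" using block[of i j] by (auto simp: \<mu>_def)
  have "\<epsilon> \<ge> 0" using close[of i j] by linarith
  have ZM: "\<bar>(Z ** M) $ i $ j\<bar> \<le> CARD('n) * (\<epsilon> * \<mu>)"
  proof -
    have "\<bar>(Z ** M) $ i $ j\<bar> \<le> (\<Sum>k\<in>(UNIV :: 'n set). \<epsilon> * \<mu>)"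
      unfolding matrix_mult_nth
      by (rule order_trans[OF sum_abs sum_mono])
        (use close le \<open>\<epsilon> \<ge> 0\<close> in \<open>auto simp: abs_mult Z_def intro!: mult_mono\<close>)
    then show ?thesis by simp
  qed
  have MZ: "\<bar>(M ** Z) $ i $ j\<bar> \<le> CARD('n) * (\<epsilon> * \<mu>)"
  proof -
    have "\<bar>(M ** Z) $ i $ j\<bar> \<le> (\<Sum>k\<in>(UNIV :: 'n set). \<mu> * \<epsilon>)"
      unfolding matrix_mult_nth
      by (rule order_trans[OF sum_abs sum_mono])
        (use close le \<open>\<mu> > 0\<close> in \<open>auto simp: abs_mult Z_def intro!: mult_mono\<close>)
    then show ?thesis by (simp add: mult.commute)
  qed
  have Y: "Y = diagm a + Z" by (simp add: Z_def)
  have "(diagm a ** M) $ i $ j + (Z ** M) $ i $ j = (M ** diagm a) $ i $ j + (M ** Z) $ i $ j"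
    using comm unfolding Y bounded_bilinear.add_left[OF bounded_bilinear_matrix_mult]
      bounded_bilinear.add_right[OF bounded_bilinear_matrix_mult] by (metis vector_add_component)
  then have "(a i - a j) * M $ i $ j = (M ** Z) $ i $ j - (Z ** M) $ i $ j"
    by (simp add: diagm_mult_left diagm_mult_right algebra_simps)
  then have "\<bar>a i - a j\<bar> * \<mu> = \<bar>(M ** Z) $ i $ j - (Z ** M) $ i $ j\<bar>"
    by (simp add: \<mu>_def abs_mult[symmetric])
  also have "\<dots> \<le> 2 * CARD('n) * \<epsilon> * \<mu>" using ZM MZ by (simp add: abs_if split: if_splits)
  also have "\<dots> < \<delta> * \<mu>" using small \<open>\<mu> > 0\<close> by simp
  also have "\<dots> \<le> \<bar>a i - a j\<bar> * \<mu>" using gap[OF \<open>a i \<noteq> a j\<close>] \<open>\<mu> > 0\<close> by simp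
  finally show False by simp
qed

text \<open>Closeness is used twice: the ball lets \<open>commuting_block_zero\<close> kill the
  entries of \<open>matpoly ls Y\<close> outside the blocks, and the open sets \<open>R l\<close>
  keep the traces near those of \<open>diagm a\<close>, which fixes the multiplicities.\<close>

lemma orbit_locally_block_zero:
  fixes a :: "'n::finite \<Rightarrow> real"
  assumes ls: "set ls = range a"
  shows "\<exists>N. open N \<and> diagm a \<in> N \<and> (\<forall>Y\<in>N. Y \<in> Sym \<longrightarrow>
    (\<forall>i j. a i = a j \<longrightarrow> matpoly ls Y $ i $ j = 0) \<longrightarrow> Y \<in> orbit (diagm a))"
proof -
  obtain \<delta> where \<delta>: "\<delta> > 0" "\<And>i j. a i \<noteq> a j \<Longrightarrow> \<delta> \<le> \<bar>a i - a j\<bar>" using ex_gap[of a] by blast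
  define \<epsilon> where "\<epsilon> = \<delta> / (4 * CARD('n))"
  have \<epsilon>: "\<epsilon> > 0" "2 * CARD('n) * \<epsilon> < \<delta>" using \<delta>(1) by (simp_all add: \<epsilon>_def field_simps)
  define R where "R = (\<lambda>l. {Y :: real^'n^'n. \<bar>trace (matpoly (removeAll l ls) Y) -
      trace (matpoly (removeAll l ls) (diagm a))\<bar> < \<bar>\<Prod>m\<leftarrow>removeAll l ls. l - m\<bar>})"
  have cont: "continuous_on UNIV (\<lambda>Y :: real^'n^'n. trace (matpoly rs Y))" for rs
    unfolding trace_def by (intro continuous_intros continuous_on_matpoly)
  have "open (R l)" for l
    unfolding R_def by (intro open_Collect_less continuous_intros cont)
  then have "open (ball (diagm a) \<epsilon> \<inter> (\<Inter>l\<in>set ls. R l))" by (intro open_Int open_ball open_INT) auto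
  moreover have "diagm a \<in> R l" for l
    using prod_list_roots_zero_iff[of l "removeAll l ls"] by (simp add: R_def)
  moreover have "Y \<in> orbit (diagm a)" if Y: "Y \<in> ball (diagm a) \<epsilon>" "\<forall>l\<in>set ls. Y \<in> R l" "Y \<in> Sym"
    "\<forall>i j. a i = a j \<longrightarrow> matpoly ls Y $ i $ j = 0" for Y
  proof (rule mem_orbit_diagmI[OF Y(3) ls])
    have "\<bar>(Y - diagm a) $ i $ j\<bar> \<le> \<epsilon>" for i j
    proof -
      have "\<bar>(Y - diagm a) $ i $ j\<bar> \<le> norm (Y - diagm a)"
        by (rule order_trans[OF component_le_norm_cart Finite_Cartesian_Product.norm_nth_le])
      then show ?thesis using Y(1) by (simp add: dist_norm norm_minus_commute)
    qed
    then show "matpoly ls Y = 0"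
      using Y(4) \<delta>(2) \<epsilon>(2) by (intro commuting_block_zero[OF matpoly_commute]) auto
  qed (use Y(2) in \<open>auto simp: R_def\<close>)
  ultimately show ?thesis using \<epsilon>(1) by (intro exI[of _ "ball (diagm a) \<epsilon> \<inter> (\<Inter>l\<in>set ls. R l)"]) auto
qed

text \<open>The chart at \<open>diagm a\<close> inverts the map that replaces the entries in the blocks \<open>a i = a j\<close> by
  those of \<open>matpoly ls\<close> and keeps the other ones.  The symmetrization and the extra skew term make
  it a local diffeomorphism of the space of all matrices under which the symmetric matrices are the
  preimage of the symmetric matrices.\<close>

lemma smooth_submanifold_orbit:
  fixes A :: "real^'n^'n"
  assumes A: "A \<in> Sym" and a: "diagm a \<in> orbit A"
  shows "smooth_submanifold Sym (card {(i, j). a i \<noteq> a j} div 2) (orbit A)"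
proof (rule smooth_submanifoldI_local_diffeo)
  show "orbit A \<subseteq> Sym" using orbit_subset_Sym[OF A] .
  fix p assume p: "p \<in> orbit A"
  have orb: "orbit A = orbit (diagm a)" using orbit_eqI[OF a] by simp
  obtain g where g: "g \<in> SO" "p = g ** diagm a ** transpose g" using p unfolding orb by (auto simp: orbit_def)
  obtain ls where ls: "set ls = range a" "distinct ls" using finite_distinct_list[of "range a"] by auto
  define Q where "Q = {(i, j). a i \<noteq> a j}"
  \<comment> \<open>Conjugating \<open>p\<close> back to \<open>diagm a\<close> reduces the chart at
    \<open>p\<close> to the one at the diagonal representative.\<close>
  define L where "L = (\<lambda>X :: real^'n^'n. transpose g ** X ** g)"
  define S where "S = (\<lambda>Y :: real^'n^'n. (1/2) *\<^sub>R (Y + transpose Y))"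
  define B where "B = (\<lambda>Z :: real^'n^'n. \<chi> i j. if a i = a j then Z $ i $ j else 0)"
  define K where "K = (\<lambda>Y :: real^'n^'n. \<chi> i j. if a i = a j then Y $ i $ j - Y $ j $ i else Y $ i $ j)"
  define \<Phi> where "\<Phi> = (\<lambda>Y. B (matpoly ls (S Y)) + K Y)"
  have linear: "linear S" "linear B" "linear K"
    by (auto intro!: linearI simp: S_def B_def K_def vec_eq_iff transpose_nth algebra_simps)
  have bl: "bounded_linear S" "bounded_linear B" "bounded_linear K" using linear by (simp_all add: linear_linear)
  have linL: "linear L"
    unfolding L_def using linear_compose[OF linear_matrix_mult_left linear_matrix_mult_right] by (simp add: o_def)
  then have blL: "bounded_linear L" by (simp add: linear_linear)
  have Lp: "L p = diagm a" using conj_cancel(1)[OF g(1)] by (simp add: L_def g(2))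
  have L0: "V = 0" if "L V = 0" for V using conj_cancel(2)[OF g(1), of V] that by (simp add: L_def)
  have \<Phi>_nth: "\<Phi> Y $ i $ j = (if a i = a j then matpoly ls (S Y) $ i $ j + Y $ i $ j - Y $ j $ i else Y $ i $ j)"
    for Y i j by (simp add: \<Phi>_def B_def K_def)
  define F where "F = (\<lambda>X. \<Phi> (L X))"
  have "Ck_on k F UNIV" for k
    unfolding F_def \<Phi>_def
    by (intro Ck_on_add Ck_on_bounded_linear[OF bl(2)] Ck_on_bounded_linear[OF bl(3)] Ck_on_bounded_linear[OF blL]
        Ck_on_ident Ck_on_compose[OF open_UNIV open_UNIV subset_UNIV _ Ck_on_matpoly]
        Ck_on_bounded_linear[OF bl(1)] open_UNIV)
  then have "smooth_on F UNIV" by (simp add: smooth_on_def)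
  moreover have "inj (frechet_derivative F (at p))"
  proof -
    obtain M' where M': "(matpoly ls has_derivative M') (at (diagm a))"
      "\<And>V i j. a i = a j \<Longrightarrow> M' V $ i $ j = V $ i $ j * root_deriv ls (a i)"
      using matpoly_has_derivative_at_diagm by blast
    have S: "S (L p) = diagm a" by (simp add: Lp S_def transpose_diagm scaleR_2[symmetric])
    have dL: "(L has_derivative L) (at p)" using blL by (rule bounded_linear_imp_has_derivative)
    have "((\<lambda>X. S (L X)) has_derivative (\<lambda>V. S (L V))) (at p)"
      by (rule bounded_linear.has_derivative[OF bl(1) dL])
    then have "((\<lambda>X. matpoly ls (S (L X))) has_derivative (\<lambda>V. M' (S (L V)))) (at p)"
      by (rule has_derivative_compose) (simp add: S M'(1))
    then have dF: "(F has_derivative (\<lambda>V. B (M' (S (L V))) + K (L V))) (at p)"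
      unfolding F_def \<Phi>_def
      by (intro has_derivative_add bounded_linear.has_derivative[OF bl(2)] bounded_linear.has_derivative[OF bl(3)] dL)
    then have D: "frechet_derivative F (at p) = (\<lambda>V. B (M' (S (L V))) + K (L V))"
      by (rule frechet_derivative_at[symmetric])
    have linD: "linear (\<lambda>V. B (M' (S (L V))) + K (L V))"
      using dF by (rule has_derivative_linear)
    have "V = 0" if V: "B (M' (S (L V))) + K (L V) = 0" for V
    proof (rule L0)
      define U where "U = L V"
      have "U $ i $ j = 0" for i j
      proof (cases "a i = a j")
        case True
        define c where "c = root_deriv ls (a i)"
        have "c \<noteq> 0" unfolding c_def using ls(1) by (intro root_deriv_nonzero[OF ls(2)]) simp
        have e: "(B (M' (S U)) + K U) $ k $ l = 0" for k l by (simp only: U_def V zero_index)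
        \<comment> \<open>In a block the derivative is \<open>c\<close> times the symmetric part
          plus a skew difference; the entries (i, j) and (j, i) separate the two.\<close>
        have 1: "(U $ i $ j + U $ j $ i) / 2 * c + (U $ i $ j - U $ j $ i) = 0"
          using e[of i j] True M'(2)[OF True, of "S U"] by (simp add: B_def K_def S_def transpose_nth c_def)
        have 2: "(U $ i $ j + U $ j $ i) / 2 * c + (U $ j $ i - U $ i $ j) = 0"
          using e[of j i] True M'(2)[OF True[symmetric], of "S U"]
          by (simp add: B_def K_def S_def transpose_nth c_def add.commute)
        from 1 2 have "U $ j $ i = U $ i $ j" by linarith
        with 1 \<open>c \<noteq> 0\<close> show ?thesis by simp
      next
        case False
        then have "(B (M' (S U)) + K U) $ i $ j = U $ i $ j" by (simp add: B_def K_def)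
        then show ?thesis by (simp only: U_def V zero_index)
      qed
      then show "L V = 0" by (simp add: U_def vec_eq_iff)
    qed
    then show ?thesis unfolding D using linD by (intro injI_linear_kernel)
  qed
  moreover obtain N where N: "open N" "diagm a \<in> N" "\<And>Y. Y \<in> N \<Longrightarrow> Y \<in> Sym \<Longrightarrow>
    (\<forall>i j. a i = a j \<longrightarrow> matpoly ls Y $ i $ j = 0) \<Longrightarrow> Y \<in> orbit (diagm a)"
    using orbit_locally_block_zero[OF ls(1)] by blast
  have \<Phi>_iff: "\<Phi> Y \<in> signed_space 1 Q \<longleftrightarrow> Y \<in> Sym \<and> (\<forall>i j. a i = a j \<longrightarrow> matpoly ls Y $ i $ j = 0)" for Y
  proof
    assume \<Phi>: "\<Phi> Y \<in> signed_space 1 Q"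
    \<comment> \<open>Symmetrizing the argument makes the polynomial part symmetric, so comparing
      the block equations at (i, j) and (j, i) isolates the skew part of \<open>Y\<close>.\<close>
    have "transpose (S Y) = S Y" by (simp add: S_def vec_eq_iff transpose_nth add.commute)
    then have symm: "matpoly ls (S Y) $ j $ i = matpoly ls (S Y) $ i $ j" for i j
      using transpose_matpoly by (metis transpose_nth)
    have z: "matpoly ls (S Y) $ i $ j + Y $ i $ j - Y $ j $ i = 0" if "a i = a j" for i j
      using \<Phi> that \<Phi>_nth[of Y i j] by (auto simp: signed_space_def Q_def)
    have symY: "Y $ j $ i = Y $ i $ j" for i j
    proof (cases "a i = a j")
      case True
      then show ?thesis using z[of i j] z[of j i] symm[of i j] by simp
    next
      case False
      then show ?thesis using \<Phi> \<Phi>_nth[of Y i j] \<Phi>_nth[of Y j i] by (auto simp: signed_space_def)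
    qed
    then have sym: "transpose Y = Y" by (simp add: vec_eq_iff transpose_nth)
    then have SY: "S Y = Y" by (simp add: S_def scaleR_2[symmetric])
    have "matpoly ls Y $ i $ j = 0" if "a i = a j" for i j
      using z[OF that] symY[of j i] unfolding SY by linarith
    then show "Y \<in> Sym \<and> (\<forall>i j. a i = a j \<longrightarrow> matpoly ls Y $ i $ j = 0)" using sym by (simp add: Sym_def)
  next
    assume Y: "Y \<in> Sym \<and> (\<forall>i j. a i = a j \<longrightarrow> matpoly ls Y $ i $ j = 0)"
    then have sym: "transpose Y = Y" by (simp add: Sym_def)
    then have SY: "S Y = Y" by (simp add: S_def scaleR_2[symmetric])
    have symY: "Y $ j $ i = Y $ i $ j" for i j using sym by (metis transpose_nth)
    have "\<Phi> Y $ j $ i = 1 * \<Phi> Y $ i $ j" for i j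
      using Y symY[of i j] by (simp add: \<Phi>_nth SY)
    moreover have "\<Phi> Y $ i $ j = 0" if "(i, j) \<notin> Q" for i j
      using Y symY[of i j] that by (simp add: \<Phi>_nth SY Q_def)
    ultimately show "\<Phi> Y \<in> signed_space 1 Q" unfolding signed_space_def by blast
  qed
  have "X \<in> orbit A \<longleftrightarrow> F X \<in> signed_space 1 Q" if "L X \<in> N" for X
  proof -
    have "X = g ** L X ** transpose g" using conj_cancel(2)[OF g(1)] by (simp add: L_def)
    then have "X \<in> orbit A \<longleftrightarrow> L X \<in> orbit (diagm a)"
      unfolding orb using orbit_conj[of "L X" _ g] orbit_conj[of X _ "transpose g"] g(1) SO_transpose
      by (metis L_def transpose_transpose)
    also have "\<dots> \<longleftrightarrow> L X \<in> Sym \<and> (\<forall>i j. a i = a j \<longrightarrow> matpoly ls (L X) $ i $ j = 0)"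
    proof
      assume *: "L X \<in> orbit (diagm a)"
      then have "L X \<in> Sym" using orbit_subset_Sym[OF A] orb by blast
      moreover have "matpoly ls (L X) = 0"
        using matpoly_orbit(1)[OF *] matpoly_zero_iff_diagm ls(1) by blast
      ultimately show "L X \<in> Sym \<and> (\<forall>i j. a i = a j \<longrightarrow> matpoly ls (L X) $ i $ j = 0)" by simp
    qed (use N(3)[OF that] in blast)
    finally show ?thesis by (simp add: \<Phi>_iff F_def)
  qed
  moreover have "open (L -` N)"
    using N(1) blL by (intro open_vimage linear_continuous_on)
  moreover have "dim (signed_space 1 Q) = card {(i, j). a i \<noteq> a j} div 2"
    by (subst dim_signed_space) (auto simp: Q_def)
  ultimately show "\<exists>(F :: real^'n^'n \<Rightarrow> real^'n^'n) W N. smooth_on F UNIV \<and>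
      inj (frechet_derivative F (at p)) \<and> subspace W \<and> dim W = card {(i, j). a i \<noteq> a j} div 2 \<and>
      open N \<and> p \<in> N \<and> (\<forall>X\<in>N. X \<in> orbit A \<longleftrightarrow> F X \<in> W)"
    using subspace_signed_space N(2) Lp
    by (intro exI[of _ F] exI[of _ "signed_space 1 Q"] exI[of _ "L -` N"]) auto
qed

section \<open>Matrices with exactly one repeated eigenvalue\<close>

lemma eigenvalues_diagm: "eigenvalues (diagm (a :: 'n::finite \<Rightarrow> real)) = range a"
proof -
  have mv: "(diagm a *v v) $ i = a i * v $ i" for v i
    by (simp add: matrix_vector_mult_def diagm_nth if_distribR if_distrib sum.delta cong: if_cong)
  show ?thesis
  proof (intro equalityI subsetI)
    fix c assume "c \<in> eigenvalues (diagm a)"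
    then obtain v where v: "v \<noteq> 0" "diagm a *v v = c *\<^sub>R v" by (auto simp: eigenvalues_def)
    then obtain i where i: "v $ i \<noteq> 0" by (auto simp: vec_eq_iff)
    have "a i * v $ i = c * v $ i" using v(2) mv[of v i] by (metis vector_scaleR_component real_scaleR_def)
    then show "c \<in> range a" using i by (metis mult_right_cancel rangeI)
  next
    fix c assume "c \<in> range a"
    then obtain i where i: "c = a i" by blast
    have "diagm a *v axis i 1 = c *\<^sub>R axis i 1" by (auto simp: vec_eq_iff mv axis_def i)
    then show "c \<in> eigenvalues (diagm a)"
      unfolding eigenvalues_def by (auto intro!: exI[of _ "axis i 1"] simp: axis_eq_0_iff)
  qed
qed

lemma eigenvalues_orbit_subset:
  assumes "B \<in> orbit A" shows "eigenvalues A \<subseteq> eigenvalues B"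
proof
  fix c assume "c \<in> eigenvalues A"
  then obtain v where v: "v \<noteq> 0" "A *v v = c *\<^sub>R v" by (auto simp: eigenvalues_def)
  obtain g where g: "g \<in> SO" "B = g ** A ** transpose g" using assms by (auto simp: orbit_def)
  have "B ** g = g ** A" by (simp add: g(2) matrix_mul_assoc[symmetric] SO_D[OF g(1)])
  then have "B *v (g *v v) = g *v (A *v v)" by (simp add: matrix_vector_mul_assoc)
  then have "B *v (g *v v) = c *\<^sub>R (g *v v)" by (simp add: v(2) matrix_vector_mult_scaleR)
  moreover have "g *v v \<noteq> 0"
  proof
    assume "g *v v = 0"
    then have "(transpose g ** g) *v v = 0" by (simp only: matrix_vector_mul_assoc[symmetric] matrix_vector_mult_0_right)
    then show False using v(1) SO_D(1)[OF g(1)] by simp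
  qed
  ultimately show "c \<in> eigenvalues B" by (auto simp: eigenvalues_def)
qed

lemma eigenvalues_orbit: "B \<in> orbit A \<Longrightarrow> eigenvalues B = eigenvalues A"
  using eigenvalues_orbit_subset orbit_sym by blast

lemma card_distinct_pairs:
  fixes a :: "'n::finite \<Rightarrow> real"
  assumes "card (range a) = CARD('n) - 1"
  shows "card {(i, j). a i \<noteq> a j} = CARD('n) * (CARD('n) - 1) - 2"
proof -
  \<comment> \<open>With truncated subtraction the strict inequality rests on the index type being
    nonempty.\<close>
  have "card (range a) < CARD('n)" using assms by (simp add: zero_less_card_finite)
  then have "\<not> inj a" using card_image[of a UNIV] by auto
  then obtain x y where xy: "x \<noteq> y" "a x = a y" by (auto simp: inj_def)
  \<comment> \<open>Omitting \<open>y\<close> loses no value, and the remaining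
    \<open>CARD('n) - 1\<close> indices take as many values; hence {x, y} is the only coincident
    pair.\<close>
  have "range a = a ` (UNIV - {y})" using xy by (auto simp: image_iff) (metis DiffI UNIV_I singletonD)
  then have "card (a ` (UNIV - {y})) = card (UNIV - {y} :: 'n set)"
    using assms by (simp add: card_Diff_singleton)
  then have inj: "inj_on a (UNIV - {y})" by (intro eq_card_imp_inj_on) auto
  have "a i = a j \<longleftrightarrow> i = j \<or> (i, j) = (x, y) \<or> (i, j) = (y, x)" for i j
    using inj xy unfolding inj_on_def by (metis DiffI UNIV_I prod.inject singletonD)
  then have "{(i, j). a i \<noteq> a j} = {(i, j). i \<noteq> j} - {(x, y), (y, x)}" by auto
  moreover have "card ({(i :: 'n, j). i \<noteq> j} - {(x, y), (y, x)}) = card {(i :: 'n, j). i \<noteq> j} - card {(x, y), (y, x)}"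
    using xy(1) by (intro card_Diff_subset) auto
  moreover have "card {(x, y), (y, x)} = 2" using xy(1) by simp
  ultimately show ?thesis by (simp add: card_off_diagonal)
qed

text \<open>Conjugation preserves eigenvalues, so the diagonal representative has exactly one
  coincident pair of entries; the two ordered pairs it removes lower the dimension by one.\<close>

lemma smooth_submanifold_orbit_MH:
  fixes A :: "real^'n^'n"
  assumes "A \<in> MH"
  shows "smooth_submanifold Sym (CARD('n) * (CARD('n) - 1) div 2 - 1) (orbit A)"
proof -
  have A: "A \<in> Sym" "card (eigenvalues A) = CARD('n) - 1" using assms by (auto simp: MH_def)
  obtain a where a: "diagm a \<in> orbit A" using orbit_meets_Dg[OF A(1)] by (auto simp: Dg_iff)
  have "card (range a) = CARD('n) - 1"
    using A(2) eigenvalues_orbit[OF a] eigenvalues_diagm[of a] by simp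
  then have "card {(i, j). a i \<noteq> a j} div 2 = CARD('n) * (CARD('n) - 1) div 2 - 1"
    by (simp add: card_distinct_pairs)
  then show ?thesis using smooth_submanifold_orbit[OF A(1) a] by simp
qed

text \<open>The clause on \<open>SO\<close> supplies the value of dim SO(n), which the orbit
  dimension in the last clause falls short of by one.\<close>

theorem mainTheorem4:
  assumes "CARD('n::finite) > 2"
  shows
    "(\<forall>A :: real^'n^'n. A \<in> Sym \<and> A \<notin> Scal \<longrightarrow> intersects_orthogonally (orbit A) Dg) \<and>
     (\<forall>A :: real^'n^'n. A \<in> Sym \<longrightarrow>
        orbit A \<subseteq> {X \<in> Sym. \<forall>Z \<in> Scal. orthogonal (X - A) Z}) \<and>
     smooth_submanifold UNIV (CARD('n) * (CARD('n) - 1) div 2) (SO :: (real^'n^'n) set) \<and>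
     (\<forall>A :: real^'n^'n. A \<in> MH \<longrightarrow>
        smooth_submanifold Sym (CARD('n) * (CARD('n) - 1) div 2 - 1) (orbit A) \<and>
        compact (orbit A) \<and> algebraic_surface (orbit A) \<and> connected (orbit A))"
proof (intro conjI allI impI)
  fix A :: "real^'n^'n"
  show "A \<in> Sym \<and> A \<notin> Scal \<Longrightarrow> intersects_orthogonally (orbit A) Dg"
    using orbit_intersects_Dg_orthogonally by blast
  show "A \<in> Sym \<Longrightarrow> orbit A \<subseteq> {X \<in> Sym. \<forall>Z \<in> Scal. orthogonal (X - A) Z}"
    by (rule orbit_subset_hyperplane)
  show "smooth_submanifold UNIV (CARD('n) * (CARD('n) - 1) div 2) (SO :: (real^'n^'n) set)"
    by (rule smooth_submanifold_SO)
  show "A \<in> MH \<Longrightarrow> smooth_submanifold Sym (CARD('n) * (CARD('n) - 1) div 2 - 1) (orbit A)"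
    by (rule smooth_submanifold_orbit_MH)
  show "A \<in> MH \<Longrightarrow> algebraic_surface (orbit A)"
    by (rule algebraic_surface_orbit) (simp add: MH_def)
  show "compact (orbit A)" by (rule compact_orbit)
  show "connected (orbit A)" by (rule connected_orbit)
qed

end
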